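(* Let $\mathbf{A}^\#$ be a computable presentation of a (not necessarily unital) $\mathrm{C}^*$-algebra $\mathbf{A}$. If $a$ is a normal element of $\mathbf{A}$ that is a computable point of $\mathbf{A}^\#$, then $\sigma(a)$ is a computably compact subset of $\mathbb{C}$.
   Context: A presentation $\mathbf{A}^\#$ of a (separable) $\mathrm{C}^*$-algebra $\mathbf{A}$ is $\mathbf{A}$ together with a finite or infinite sequence $(a_n)$ of elements of $\mathbf{A}$, called special points, that generate a dense $*$-subalgebra. The generated points of $\mathbf{A}^\#$ are the elements $p(a_0,\dots,a_m)$ with $p$ a rational $*$-polynomial (a noncommutative polynomial in $x_0,\dots,x_m,x_0^*,\dots,x_m^*$ with coefficients in $\mathbb{Q}(i)$ and no constant term); a code of a generated point is a natural-number code of such a $p$. $\mathbf{A}^\#$ is computable if from a code of a generated point $\rho$ and $k\in\mathbb{N}$ one can compute a rational $q$ with $|\,\|\rho\|-q\,|<2^{-k}$. A point $x$ is a computable point of $\mathbf{A}^\#$ if there is an algorithm which from $k$ computes a code of a generated point $\rho$ with $\|x-\rho\|<2^{-k}$. A compact set $K\subseteq\mathbb{C}$ is computably compact if from $k\in\mathbb{N}$ one can compute a finite tuple of open balls with centres in $\mathbb{Q}(i)$ and radius $2^{-k}$ that cover $K$ and each of which meets $K$. If $\mathbf{A}$ is unital, $\sigma(a)=\sigma_{\mathbf{A}}(a)=\{\lambda\in\mathbb{C} : a-\lambda 1_{\mathbf{A}}\text{ is not invertible in }\mathbf{A}\}$. If $\mathbf{A}$ is non-unital, $\sigma(a)=\sigma_{\mathbf{A}_1}(a)$,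 where $\mathbf{A}_1$ is the unitization of $\mathbf{A}$, that is $\mathbf{A}_1=\mathbf{A}\oplus\mathbb{C}$ as a vector space with multiplication $(a,\lambda)(b,\mu)=(ab+\lambda b+\mu a,\lambda\mu)$ and unit $(0,1)$. Note that when $\mathbf{A}$ is unital the unit of $\mathbf{A}$ is not assumed to be a computable point of $\mathbf{A}^\#$. *)

theory Defs
  imports
    "HOL-Analysis.Analysis"
    "HOL-Library.Nat_Bijection"
    "HOL-Library.Countable"
    "HOL-Library.Extended_Nat"
begin

section \<open>C*-algebras and the spectrum\<close>

text \<open>
  Submultiplicativity, completeness and the real vector space structure come from
  \<^class>\<open>real_normed_algebra\<close> and \<^class>\<open>banach\<close>; neither assumes a unit.
\<close>

class cstar_algebra = real_normed_algebra + banach +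
  fixes scaleC :: "complex \<Rightarrow> 'a \<Rightarrow> 'a"  (infixr \<open>*\<^sub>C\<close> 75)
    and star :: "'a \<Rightarrow> 'a"
  assumes scaleC_add_right: "c *\<^sub>C (x + y) = c *\<^sub>C x + c *\<^sub>C y"
    and scaleC_add_left: "(c + d) *\<^sub>C x = c *\<^sub>C x + d *\<^sub>C x"
    and scaleC_scaleC: "c *\<^sub>C (d *\<^sub>C x) = (c * d) *\<^sub>C x"
    and scaleC_of_real: "complex_of_real r *\<^sub>C x = r *\<^sub>R x"
    and mult_scaleC_left: "(c *\<^sub>C x) * y = c *\<^sub>C (x * y)"
    and mult_scaleC_right: "x * (c *\<^sub>C y) = c *\<^sub>C (x * y)"
    and norm_scaleC: "norm (c *\<^sub>C x) = cmod c * norm x"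
    and star_star: "star (star x) = x"
    and star_add: "star (x + y) = star x + star y"
    and star_scaleC: "star (c *\<^sub>C x) = cnj c *\<^sub>C star x"
    and star_mult: "star (x * y) = star y * star x"
    and cstar_identity: "norm (star x * x) = (norm x)\<^sup>2"

definition normal_elem :: "'a::cstar_algebra \<Rightarrow> bool" where
  "normal_elem a \<longleftrightarrow> star a * a = a * star a"

definition algebra_unit :: "'a::cstar_algebra \<Rightarrow> bool" where
  "algebra_unit e \<longleftrightarrow> (\<forall>x. e * x = x \<and> x * e = x)"

definition unital :: "'a::cstar_algebra itself \<Rightarrow> bool" where
  "unital _ \<longleftrightarrow> (\<exists>e::'a. algebra_unit e)"

definition unit_of :: "'a::cstar_algebra itself \<Rightarrow> 'a" where
  "unit_of _ = (THE e. algebra_unit e)"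

text \<open>
  The unitization is the product type with its componentwise vector space structure, the unit
  \<open>(0, 1)\<close> and the following multiplication. Its norm is not needed to define the spectrum.
\<close>

fun unitization_mult :: "'a::cstar_algebra \<times> complex \<Rightarrow> 'a \<times> complex \<Rightarrow> 'a \<times> complex" where
  "unitization_mult (a, l) (b, m) = (a * b + l *\<^sub>C b + m *\<^sub>C a, l * m)"

definition invertible_wrt :: "('b \<Rightarrow> 'b \<Rightarrow> 'b) \<Rightarrow> 'b \<Rightarrow> 'b \<Rightarrow> bool" where
  "invertible_wrt mul e x \<longleftrightarrow> (\<exists>y. mul x y = e \<and> mul y x = e)"

definition cstar_spectrum :: "'a::cstar_algebra \<Rightarrow> complex set" where
  "cstar_spectrum a =
     (if unital TYPE('a)
      then {l. \<not> invertible_wrt (*) (unit_of TYPE('a)) (a - l *\<^sub>C unit_of TYPE('a))}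
      else {l. \<not> invertible_wrt unitization_mult (0, 1) ((a, 0) - (0, l))})"

definition star_subalgebra :: "'a::cstar_algebra set \<Rightarrow> bool" where
  "star_subalgebra S \<longleftrightarrow> 0 \<in> S \<and> (\<forall>x\<in>S. \<forall>y\<in>S. x + y \<in> S \<and> x * y \<in> S) \<and>
     (\<forall>x\<in>S. star x \<in> S \<and> (\<forall>c. c *\<^sub>C x \<in> S))"

section \<open>Total recursive functions\<close>

text \<open>
  \<open>recursive n f\<close>: the restriction of \<open>f\<close> to lists of length \<open>n\<close> is a total recursive function
  of \<open>n\<close> arguments. Minimization is applied only to regular functions, which by Kleene's
  normal form theorem yields exactly the total computable functions. The values of \<open>f\<close> on lists
  of any other length carry no information.
\<close>

inductive recursive :: "nat \<Rightarrow> (nat list \<Rightarrow> nat) \<Rightarrow> bool" where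
  rec_zero: "recursive n (\<lambda>_. 0)"
| rec_suc: "recursive 1 (\<lambda>xs. Suc (xs ! 0))"
| rec_proj: "i < n \<Longrightarrow> recursive n (\<lambda>xs. xs ! i)"
| rec_comp: "recursive (length hs) g \<Longrightarrow> (\<forall>h\<in>set hs. recursive n h) \<Longrightarrow>
    recursive n (\<lambda>xs. g (map (\<lambda>h. h xs) hs))"
| rec_prim: "recursive n f \<Longrightarrow> recursive (Suc (Suc n)) g \<Longrightarrow>
    recursive (Suc n) (\<lambda>xs. rec_nat (f (tl xs)) (\<lambda>k r. g (k # r # tl xs)) (hd xs))"
| rec_mu: "recursive (Suc n) f \<Longrightarrow> (\<forall>xs. length xs = n \<longrightarrow> (\<exists>y. f (y # xs) = 0)) \<Longrightarrow>
    recursive n (\<lambda>xs. LEAST y. f (y # xs) = 0)"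

section \<open>Codes of rational *-polynomials\<close>

text \<open>
  Codes are built from the pairing, sum and list bijections of the library, so every
  natural number is a code, and every polynomial with coefficients in Q(i) has one.
\<close>

definition decode_gauss_rat :: "nat \<Rightarrow> complex" where
  "decode_gauss_rat n = (case prod_decode n of (x, y) \<Rightarrow>
     Complex (of_rat (nat_to_rat_surj x)) (of_rat (nat_to_rat_surj y)))"

text \<open>
  The letter \<open>Inl i\<close> stands for $x_i$ and \<open>Inr i\<close> for $x_i^*$. A monomial is a coefficient with a
  word given by its first letter and the list of the others; words are therefore nonempty, which
  excludes constant terms. A polynomial is a finite formal sum of monomials.
\<close>

type_synonym letter = "nat + nat"
type_synonym star_monomial = "complex \<times> letter \<times> letter list"
type_synonym star_poly = "star_monomial list"

definition decode_monomial :: "nat \<Rightarrow> star_monomial" where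
  "decode_monomial n = (case prod_decode n of (c, w) \<Rightarrow>
     case prod_decode w of (l, ls) \<Rightarrow>
       (decode_gauss_rat c, sum_decode l, map sum_decode (list_decode ls)))"

definition decode_poly :: "nat \<Rightarrow> star_poly" where
  "decode_poly n = map decode_monomial (list_decode n)"

fun letter_var :: "letter \<Rightarrow> nat" where
  "letter_var (Inl i) = i"
| "letter_var (Inr i) = i"

fun monomial_vars :: "star_monomial \<Rightarrow> nat set" where
  "monomial_vars (c, l, ls) = letter_var ` set (l # ls)"

definition poly_vars :: "star_poly \<Rightarrow> nat set" where
  "poly_vars p = (\<Union>m\<in>set p. monomial_vars m)"

fun eval_letter :: "(nat \<Rightarrow> 'a::cstar_algebra) \<Rightarrow> letter \<Rightarrow> 'a" where
  "eval_letter s (Inl i) = s i"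
| "eval_letter s (Inr i) = star (s i)"

fun eval_monomial :: "(nat \<Rightarrow> 'a::cstar_algebra) \<Rightarrow> star_monomial \<Rightarrow> 'a" where
  "eval_monomial s (c, l, ls) = c *\<^sub>C foldl (\<lambda>x l'. x * eval_letter s l') (eval_letter s l) ls"

definition eval_poly :: "(nat \<Rightarrow> 'a::cstar_algebra) \<Rightarrow> star_poly \<Rightarrow> 'a" where
  "eval_poly s p = sum_list (map (eval_monomial s) p)"

section \<open>Presentations\<close>

text \<open>
  A presentation is given by the length \<open>N\<close> (possibly \<open>\<infinity>\<close>) of the sequence of special points
  and a function \<open>s\<close> of which only the values at \<open>i < N\<close> are special points.
\<close>

definition presentation :: "enat \<Rightarrow> (nat \<Rightarrow> 'a::cstar_algebra) \<Rightarrow> bool" where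
  "presentation N s \<longleftrightarrow> closure (star_subalgebra hull {s i | i. enat i < N}) = UNIV"

definition is_code :: "enat \<Rightarrow> nat \<Rightarrow> bool" where
  "is_code N c \<longleftrightarrow> (\<forall>i\<in>poly_vars (decode_poly c). enat i < N)"

definition generated_point :: "(nat \<Rightarrow> 'a::cstar_algebra) \<Rightarrow> nat \<Rightarrow> 'a" where
  "generated_point s c = eval_poly s (decode_poly c)"

text \<open>
  For each \<open>N\<close> the set of codes is decidable, so asking for a total recursive function that is
  correct on codes is the same as asking for a partial one that is defined on codes.
\<close>

definition computable_presentation :: "enat \<Rightarrow> (nat \<Rightarrow> 'a::cstar_algebra) \<Rightarrow> bool" where
  "computable_presentation N s \<longleftrightarrow> presentation N s \<and>
     (\<exists>f. recursive 2 f \<and> (\<forall>c k. is_code N c \<longrightarrow>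
        \<bar>norm (generated_point s c) - of_rat (nat_to_rat_surj (f [c, k]))\<bar> < (1 / 2) ^ k))"

definition computable_point :: "enat \<Rightarrow> (nat \<Rightarrow> 'a::cstar_algebra) \<Rightarrow> 'a \<Rightarrow> bool" where
  "computable_point N s x \<longleftrightarrow>
     (\<exists>f. recursive 1 f \<and> (\<forall>k. is_code N (f [k]) \<and>
        norm (x - generated_point s (f [k])) < (1 / 2) ^ k))"

section \<open>Computably compact subsets of the plane\<close>

definition computably_compact :: "complex set \<Rightarrow> bool" where
  "computably_compact K \<longleftrightarrow> compact K \<and>
     (\<exists>f. recursive 1 f \<and> (\<forall>k. let B = set (list_decode (f [k])) in
        K \<subseteq> (\<Union>c\<in>B. ball (decode_gauss_rat c) ((1 / 2) ^ k)) \<and>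
        (\<forall>c\<in>B. ball (decode_gauss_rat c) ((1 / 2) ^ k) \<inter> K \<noteq> {})))"

end

theory Submission
  imports Defs
begin

text \<open>
  Everything is read off the operator \<open>T\<^sub>l x = a x - l x\<close> on the algebra itself, which treats the
  unital and the non-unital case alike: an inverse of \<open>a - l\<close>, in the algebra or in its unitization,
  acts as an inverse of \<open>T\<^sub>l\<close>, and conversely a bijective \<open>T\<^sub>l\<close> yields such an inverse
  (\<open>not_in_spectrum_imp_bounded_below\<close>, \<open>bij_shifted_mult_imp_not_in_spectrum\<close>). For normal \<open>a\<close> three
  facts about \<open>T\<^sub>l\<close> suffice; they follow from the C*-identity, by contractions and by averaging over
  roots of unity.

  \<^item> If \<open>T\<^sub>l\<close> is bounded below, then it is onto; so the spectrum consists of the \<open>l\<close> with approximate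
    eigenvectors (\<open>surj_shifted_mult\<close>, \<open>in_spectrum_iff\<close>).

  \<^item> The best lower bound of \<open>T\<^sub>l\<close> is the distance from \<open>l\<close> to the spectrum. Hence a single \<open>b\<close> with
    \<open>\<parallel>a b - l b\<parallel> < \<delta> \<parallel>b\<parallel>\<close> proves that the ball of radius \<open>\<delta>\<close> around \<open>l\<close> meets the spectrum
    (\<open>spectrum_meets_ball\<close>).

  \<^item> For every \<open>b\<close>, each \<open>m\<close> in the spectrum satisfies \<open>\<bar>m\<bar> \<le> \<parallel>a b - l b - a\<parallel> + \<bar>m - l\<bar> \<parallel>b\<parallel>\<close>
    (\<open>spectrum_excluded\<close>). An approximate solution \<open>b\<close> of \<open>a b - l b = a\<close> therefore keeps the
    spectrum, except for points close to \<open>0\<close>, away from \<open>l\<close>. Such a \<open>b\<close> exists if \<open>T\<^sub>l\<close> is bounded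
    below, with a bound on \<open>\<parallel>b\<parallel>\<close>. The certificate is a statement about elements of the algebra
    only, so no approximation of a unit has to be computed.

  Both certificates are strict inequalities between norms of generated points, so they are found by
  a search. Given \<open>k\<close>, the algorithm runs through a grid whose mesh is so fine that a certificate of
  the second kind at a grid point excludes all nearby points that are not too close to \<open>0\<close>, and
  searches at each grid point \<open>g\<close> until it finds either kind of certificate: if the ball of radius \<open>2\<^sup>-\<^sup>k\<close> around \<open>g\<close> does not
  meet the spectrum, then \<open>T\<^sub>g\<close> is bounded below by \<open>2\<^sup>-\<^sup>k\<close>, so one of them exists
  (\<open>search_succeeds\<close>). The balls certified by the first kind form the cover. The point \<open>0\<close>, at which the
  second kind degenerates, is added to the cover if it belongs to the spectrum; otherwise the spectrum
  has a positive distance from it.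

  For the recursion theory, functions of several variables become unary functions of a paired
  environment, and the arithmetic of rational *-polynomials is carried out on their codes by folds
  over coded lists.
\<close>

section \<open>Shifted left multiplications\<close>

definition shifted_mult :: "'a::cstar_algebra \<Rightarrow> complex \<Rightarrow> 'a \<Rightarrow> 'a" where
  "shifted_mult a l x = a * x - l *\<^sub>C x"

lemma scaleC_zero_right [simp]: "c *\<^sub>C (0::'a::cstar_algebra) = 0"
  using scaleC_add_right[of c 0 "0::'a"] by simp

lemma scaleC_zero_left [simp]: "0 *\<^sub>C (x::'a::cstar_algebra) = 0"
  using scaleC_of_real[of 0 x] by simp

lemma scaleC_one [simp]: "1 *\<^sub>C (x::'a::cstar_algebra) = x"
  using scaleC_of_real[of 1 x] by simp

lemma scaleC_minus_right [simp]: "c *\<^sub>C (- x) = - (c *\<^sub>C (x::'a::cstar_algebra))"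
  using scaleC_add_right[of c "- x" x] by (simp add: eq_neg_iff_add_eq_0)

lemma scaleC_minus_left [simp]: "(- c) *\<^sub>C x = - (c *\<^sub>C (x::'a::cstar_algebra))"
  using scaleC_add_left[of "- c" c x] by (simp add: eq_neg_iff_add_eq_0)

lemma scaleC_diff_right: "c *\<^sub>C (x - y) = c *\<^sub>C x - c *\<^sub>C (y::'a::cstar_algebra)"
  using scaleC_add_right[of c x "- y"] by simp

lemma scaleC_diff_left: "(c - d) *\<^sub>C x = c *\<^sub>C x - d *\<^sub>C (x::'a::cstar_algebra)"
  using scaleC_add_left[of c "- d" x] by simp

lemma scaleC_sum_right: "c *\<^sub>C sum f I = (\<Sum>i\<in>I. c *\<^sub>C (f i::'a::cstar_algebra))"
  by (induction I rule: infinite_finite_induct) (auto simp: scaleC_add_right)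

lemma scaleC_sum_left: "sum f I *\<^sub>C (x::'a::cstar_algebra) = (\<Sum>i\<in>I. f i *\<^sub>C x)"
  by (induction I rule: infinite_finite_induct) (auto simp: scaleC_add_left)

lemma scaleC_scaleR: "c *\<^sub>C (r *\<^sub>R x) = r *\<^sub>R (c *\<^sub>C (x::'a::cstar_algebra))"
  unfolding scaleC_of_real[symmetric] scaleC_scaleC by (simp add: mult.commute)

lemma star_zero [simp]: "star (0::'a::cstar_algebra) = 0"
  using star_add[of 0 "0::'a"] by simp

lemma star_minus [simp]: "star (- x) = - star (x::'a::cstar_algebra)"
  using star_add[of "- x" x] by (simp add: eq_neg_iff_add_eq_0)

lemma star_diff: "star (x - y) = star x - star (y::'a::cstar_algebra)"
  using star_add[of x "- y"] by simp

text \<open>The C*-identity and submultiplicativity give \<open>\<parallel>y\<parallel> \<le> \<parallel>y\<^sup>*\<parallel>\<close>, for \<open>x\<close> and for its adjoint.\<close>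

lemma norm_star [simp]: "norm (star x) = norm (x::'a::cstar_algebra)"
proof -
  have le: "norm y \<le> norm (star y)" for y :: 'a
  proof (cases "y = 0")
    case False
    have "norm y * norm y \<le> norm (star y) * norm y"
      by (metis cstar_identity norm_mult_ineq power2_eq_square)
    then show ?thesis using False by simp
  qed simp
  show ?thesis using le[of x] le[of "star x"] by (simp add: star_star)
qed

lemma shifted_mult_diff: "shifted_mult a l (x - y) = shifted_mult a l x - shifted_mult a l y"
  by (simp add: shifted_mult_def scaleC_diff_right algebra_simps)

lemma shifted_mult_zero [simp]: "shifted_mult a l 0 = 0"
  by (simp add: shifted_mult_def)

lemma shifted_mult_sum: "shifted_mult a l (sum f I) = (\<Sum>i\<in>I. shifted_mult a l (f i))"
  by (simp add: shifted_mult_def scaleC_sum_right sum_distrib_left sum_subtractf)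

lemma shifted_mult_scaleC: "shifted_mult a l (c *\<^sub>C x) = c *\<^sub>C shifted_mult a l x"
  by (simp add: shifted_mult_def mult_scaleC_right scaleC_scaleC scaleC_diff_right mult.commute)

lemma shifted_mult_times: "shifted_mult a l (x * y) = shifted_mult a l x * y"
  by (simp add: shifted_mult_def mult_scaleC_left algebra_simps mult.assoc)

lemma shifted_mult_shift: "shifted_mult a l x = shifted_mult a m x + (m - l) *\<^sub>C x"
  by (simp add: shifted_mult_def scaleC_diff_left)

lemma norm_shifted_mult_le: "norm (shifted_mult a l x) \<le> (norm a + cmod l) * norm x"
  using norm_triangle_ineq4[of "a * x" "l *\<^sub>C x"] norm_mult_ineq[of a x]
  by (simp add: shifted_mult_def norm_scaleC distrib_right)

lemma norm_shifted_mult_shift: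
  "norm (shifted_mult a l x) \<le> norm (shifted_mult a m x) + cmod (m - l) * norm x"
  using norm_triangle_ineq[of "shifted_mult a m x" "(m - l) *\<^sub>C x"]
  by (simp add: shifted_mult_shift[of a l x m] norm_scaleC)

lemma star_shifted_mult: "star (shifted_mult a l x) * y = star x * shifted_mult (star a) (cnj l) y"
  by (simp add: shifted_mult_def star_diff star_mult star_scaleC mult_scaleC_left
      mult_scaleC_right algebra_simps mult.assoc)

lemma shifted_mult_commute:
  assumes "normal_elem a"
  shows "shifted_mult (star a) (cnj l) (shifted_mult a l x)
    = shifted_mult a l (shifted_mult (star a) (cnj l) x)"
proof -
  have "star a * (a * x) = a * (star a * x)"
    using assms by (metis mult.assoc normal_elem_def)
  then show ?thesis
    by (simp add: shifted_mult_def scaleC_diff_right mult_scaleC_right right_diff_distrib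
        scaleC_scaleC mult.commute[of l])
qed

text \<open>
  The C*-identity turns an algebra into a Hilbert module over itself, with the inner product
  \<open>star x * y\<close>; in it a normal operator and its adjoint have the same norm at every vector.
\<close>

lemma norm_shifted_mult_star:
  assumes "normal_elem a"
  shows "norm (shifted_mult (star a) (cnj l) x) = norm (shifted_mult a l x)"
proof -
  let ?T = "shifted_mult a l" and ?S = "shifted_mult (star a) (cnj l)"
  have "star (?T x) * ?T x = star (?S x) * ?S x"
    using star_shifted_mult[of a l x "?T x"] star_shifted_mult[of "star a" "cnj l" x "?S x"]
      shifted_mult_commute[OF assms, of l x] by (simp add: star_star)
  then have "(norm (?T x))\<^sup>2 = (norm (?S x))\<^sup>2"
    by (metis cstar_identity)
  then show ?thesis by (simp add: power2_eq_iff_nonneg)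
qed

text \<open>
  Consequently the norms \<open>\<parallel>T\<^sup>n x\<parallel>\<close> form a log-convex sequence: the ratios of consecutive norms
  increase along an orbit.
\<close>

lemma norm_shifted_mult_log_convex:
  assumes "normal_elem a"
  shows "(norm (shifted_mult a l x))\<^sup>2 \<le> norm x * norm (shifted_mult a l (shifted_mult a l x))"
proof -
  let ?T = "shifted_mult a l" and ?S = "shifted_mult (star a) (cnj l)"
  have "(norm (?T x))\<^sup>2 = norm (star x * ?S (?T x))"
    by (metis cstar_identity star_shifted_mult)
  also have "\<dots> \<le> norm x * norm (?S (?T x))"
    using norm_mult_ineq[of "star x" "?S (?T x)"] by simp
  finally show ?thesis
    by (simp add: norm_shifted_mult_star[OF assms])
qed

section \<open>Normal elements: bounded below implies invertible\<close>

text \<open>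
  A solution of \<open>G x + K x = y\<close> is a fixed point of \<open>x \<mapsto> G\<^sup>-\<^sup>1 (y - K x)\<close>, which is a contraction with
  constant \<open>q / c\<close>.
\<close>

lemma surj_perturb:
  fixes G K :: "'b::banach \<Rightarrow> 'b"
  assumes "surj G"
    and low: "\<And>x y. c * norm (x - y) \<le> norm (G x - G y)"
    and up: "\<And>x y. norm (K x - K y) \<le> q * norm (x - y)"
    and "0 \<le> q" "q < c"
  shows "surj (\<lambda>x. G x + K x)"
proof -
  have "\<exists>x. y = G x + K x" for y
  proof -
    define h where "h x = inv G (y - K x)" for x
    have G_h: "G (h x) = y - K x" for x
      using \<open>surj G\<close> by (simp add: h_def surj_f_inv_f)
    have "dist (h u) (h v) \<le> (q / c) * dist u v" for u v
    proof -
      have "c * norm (h u - h v) \<le> norm (K v - K u)"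
        using low[of "h u" "h v"] by (simp add: G_h)
      also have "\<dots> \<le> q * norm (u - v)"
        using up[of v u] by (simp add: norm_minus_commute)
      finally show ?thesis
        using \<open>0 \<le> q\<close> \<open>q < c\<close> by (simp add: dist_norm field_simps)
    qed
    moreover have "0 \<le> q / c" "q / c < 1" using \<open>0 \<le> q\<close> \<open>q < c\<close> by auto
    ultimately obtain x where "h x = x"
      using banach_fix_type[of "q / c" h] by (auto simp: Ex1_def)
    then show ?thesis using G_h[of x] by (metis diff_add_cancel)
  qed
  then show ?thesis by (simp add: surj_def)
qed

text \<open>
  With \<open>T\<close> the operator and \<open>S\<close> its adjoint, \<open>H = S \<circ> T\<close> is self-adjoint and bounded below. The
  C*-identity makes \<open>H + i t\<close> a perturbation of a scalar of larger modulus as soon as \<open>t\<close> is large,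
  so \<open>H - i \<beta>\<close> is onto for every \<open>\<beta> > 0\<close>; for small \<open>\<beta>\<close> the operator \<open>H\<close> is a perturbation of it,
  hence onto, and \<open>H = T \<circ> S\<close> by normality.
\<close>

lemma surj_shifted_mult:
  assumes a: "normal_elem a" and "0 < c"
    and low: "\<And>x. c * norm x \<le> norm (shifted_mult a l x)"
  shows "surj (shifted_mult a l)"
proof -
  let ?T = "shifted_mult a l" and ?S = "shifted_mult (star a) (cnj l)"
  define H where "H x = ?S (?T x)" for x
  define B where "B = (norm a + cmod l)\<^sup>2"
  have H_diff: "H (x - y) = H x - H y" for x y
    by (simp add: H_def shifted_mult_diff)
  have H_adj: "star (H x) * y = star x * H y" for x y
    using star_shifted_mult[of "star a" "cnj l" "?T x" y] star_shifted_mult[of a l x "?T y"]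
    by (simp add: H_def star_star)
  have "0 \<le> B" by (simp add: B_def)
  have H_up: "norm (H x) \<le> B * norm x" for x
  proof -
    have "norm (H x) \<le> (norm a + cmod l) * norm (?T x)"
      using norm_shifted_mult_le[of "star a" "cnj l" "?T x"] by (simp add: H_def)
    also have "\<dots> \<le> (norm a + cmod l) * ((norm a + cmod l) * norm x)"
      by (intro mult_left_mono norm_shifted_mult_le) auto
    finally show ?thesis by (simp add: B_def power2_eq_square)
  qed
  have H_low: "c\<^sup>2 * norm x \<le> norm (H x)" for x
  proof -
    have "c\<^sup>2 * norm x \<le> c * norm (?T x)"
      using low[of x] \<open>0 < c\<close> by (simp add: power2_eq_square)
    also have "\<dots> \<le> norm (?T (?T x))" by (rule low)
    finally show ?thesis by (simp add: H_def norm_shifted_mult_star[OF a])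
  qed
  \<comment> \<open>The mixed terms cancel because \<open>H\<close> is self-adjoint; so the growth in \<open>t\<close> is that of a
      right-angled triangle.\<close>
  have skew: "norm (H x + (\<i> * of_real t) *\<^sub>C x) \<le> sqrt (B\<^sup>2 + t\<^sup>2) * norm x" for x t
  proof -
    define v where "v = H x + (\<i> * of_real t) *\<^sub>C x"
    have ii: "\<i> * of_real t * (\<i> * of_real t) = - (of_real t * of_real t :: complex)"
      by (simp add: complex_eq_iff)
    have "star v * v = star x * (H (H x) + t\<^sup>2 *\<^sub>R x)"
      by (simp add: v_def star_add star_scaleC H_adj mult_scaleC_left mult_scaleC_right
          scaleC_scaleC scaleC_add_right scaleC_diff_right distrib_left distrib_right
          left_diff_distrib power2_eq_square ii
          flip: scaleC_of_real)
    then have "(norm v)\<^sup>2 \<le> norm x * norm (H (H x) + t\<^sup>2 *\<^sub>R x)"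
      using norm_mult_ineq[of "star x" "H (H x) + t\<^sup>2 *\<^sub>R x"] by (simp flip: cstar_identity)
    also have "\<dots> \<le> norm x * (B * (B * norm x) + t\<^sup>2 * norm x)"
    proof (intro mult_left_mono order.trans[OF norm_triangle_ineq] add_mono)
      show "norm (H (H x)) \<le> B * (B * norm x)"
        using H_up[of "H x"] mult_left_mono[OF H_up[of x] \<open>0 \<le> B\<close>] by linarith
    qed auto
    also have "\<dots> = (sqrt (B\<^sup>2 + t\<^sup>2) * norm x)\<^sup>2"
      by (simp add: power_mult_distrib power2_eq_square algebra_simps)
    finally show ?thesis
      unfolding v_def by (rule power2_le_imp_le) simp
  qed
  \<comment> \<open>The second perturbation below adds \<open>i \<beta>\<close> to an operator bounded below by \<open>c\<^sup>2 - \<beta>\<close>, which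
      requires \<open>2 \<beta> < c\<^sup>2\<close>.\<close>
  define \<beta> where "\<beta> = c\<^sup>2 / 4"
  have "0 < \<beta>" "\<beta> < c\<^sup>2 - \<beta>" using \<open>0 < c\<close> by (simp_all add: \<beta>_def)
  \<comment> \<open>This makes \<open>B\<^sup>2 + t\<^sup>2 < (\<beta> + t)\<^sup>2\<close>.\<close>
  define t where "t = B\<^sup>2 / (2 * \<beta>)"
  have "0 \<le> t" using \<open>0 < \<beta>\<close> by (simp add: t_def)
  have "B\<^sup>2 + t\<^sup>2 < (\<beta> + t)\<^sup>2"
    using \<open>0 < \<beta>\<close> by (simp add: t_def power2_eq_square field_simps)
  then have t: "sqrt (B\<^sup>2 + t\<^sup>2) < \<beta> + t"
    using \<open>0 < \<beta>\<close> \<open>0 \<le> t\<close> by (intro real_less_lsqrt) auto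
  define z where "z = - (\<i> * of_real (\<beta> + t))"
  have "cmod z = \<beta> + t" using \<open>0 < \<beta>\<close> \<open>0 \<le> t\<close> by (simp add: z_def norm_mult del: of_real_add)
  then have "z \<noteq> 0" using \<open>0 < \<beta>\<close> \<open>0 \<le> t\<close> by auto
  have "surj (\<lambda>x. z *\<^sub>C x + (H x + (\<i> * of_real t) *\<^sub>C x))"
  proof (rule surj_perturb[where c = "\<beta> + t" and q = "sqrt (B\<^sup>2 + t\<^sup>2)"])
    show "surj (\<lambda>x. z *\<^sub>C (x::'a))"
      using \<open>z \<noteq> 0\<close> by (intro surjI[where g = "\<lambda>x. z *\<^sub>C x" and f = "\<lambda>x. inverse z *\<^sub>C x"])
        (simp add: scaleC_scaleC)
    show "(\<beta> + t) * norm (x - y) \<le> norm (z *\<^sub>C x - z *\<^sub>C y)" for x y :: 'a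
      using \<open>cmod z = \<beta> + t\<close> by (simp add: norm_scaleC flip: scaleC_diff_right)
    show "norm (H x + (\<i> * of_real t) *\<^sub>C x - (H y + (\<i> * of_real t) *\<^sub>C y))
        \<le> sqrt (B\<^sup>2 + t\<^sup>2) * norm (x - y)" for x y
      using skew[of "x - y" t] by (simp add: H_diff scaleC_diff_right algebra_simps)
  qed (use t in auto)
  moreover have "z *\<^sub>C x + (H x + (\<i> * of_real t) *\<^sub>C x) = H x - (\<i> * of_real \<beta>) *\<^sub>C x" for x
    by (simp add: z_def algebra_simps scaleC_add_left scaleC_diff_left)
  ultimately have surj_shift: "surj (\<lambda>x. H x - (\<i> * of_real \<beta>) *\<^sub>C x)" by simp
  have "surj (\<lambda>x. (H x - (\<i> * of_real \<beta>) *\<^sub>C x) + (\<i> * of_real \<beta>) *\<^sub>C x)"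
  proof (rule surj_perturb[where c = "c\<^sup>2 - \<beta>" and q = \<beta>])
    show "(c\<^sup>2 - \<beta>) * norm (x - y)
        \<le> norm ((H x - (\<i> * of_real \<beta>) *\<^sub>C x) - (H y - (\<i> * of_real \<beta>) *\<^sub>C y))" for x y
    proof -
      have "norm ((\<i> * of_real \<beta>) *\<^sub>C (x - y)) = \<beta> * norm (x - y)"
        using \<open>0 < \<beta>\<close> by (simp add: norm_scaleC norm_mult)
      then have "(c\<^sup>2 - \<beta>) * norm (x - y) \<le> norm (H (x - y) - (\<i> * of_real \<beta>) *\<^sub>C (x - y))"
        using H_low[of "x - y"] norm_triangle_ineq2[of "H (x - y)" "(\<i> * of_real \<beta>) *\<^sub>C (x - y)"]
        by (simp add: algebra_simps)
      then show ?thesis by (simp add: H_diff scaleC_diff_right algebra_simps)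
    qed
    show "norm ((\<i> * of_real \<beta>) *\<^sub>C x - (\<i> * of_real \<beta>) *\<^sub>C y) \<le> \<beta> * norm (x - y)" for x y :: 'a
      using \<open>0 < \<beta>\<close> by (simp add: norm_scaleC norm_mult flip: scaleC_diff_right)
  qed (use surj_shift \<open>0 < \<beta>\<close> \<open>\<beta> < c\<^sup>2 - \<beta>\<close> in simp_all)
  then have "surj H" by simp
  moreover have "H x = ?T (?S x)" for x
    unfolding H_def by (rule shifted_mult_commute[OF a])
  ultimately show ?thesis
    by (metis surj_def)
qed

lemma unital_algebra_unit:
  assumes "unital TYPE('a::cstar_algebra)"
  shows "algebra_unit (unit_of TYPE('a))"
proof -
  obtain e :: 'a where "algebra_unit e" using assms by (auto simp: unital_def)
  moreover have "e' = e" if "algebra_unit e'" for e'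
    using that \<open>algebra_unit e\<close> by (metis algebra_unit_def)
  ultimately show ?thesis
    unfolding unit_of_def by (rule theI)
qed

text \<open>
  An inverse of \<open>a - l\<close>, in the algebra or in its unitization, acts on the algebra from the left and
  so bounds the operator from below.
\<close>

lemma not_in_spectrum_imp_bounded_below:
  fixes a :: "'a::cstar_algebra"
  assumes "l \<notin> cstar_spectrum a"
  shows "\<exists>c>0. \<forall>x. c * norm x \<le> norm (shifted_mult a l x)"
proof -
  have *: ?thesis if "\<And>x. norm x \<le> K * norm (shifted_mult a l x)" "0 \<le> K" for K
  proof (intro exI conjI allI)
    fix x
    have "norm x \<le> (K + 1) * norm (shifted_mult a l x)"
      using that(1)[of x] by (simp add: algebra_simps add_increasing)
    then show "1 / (K + 1) * norm x \<le> norm (shifted_mult a l x)"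
      using \<open>0 \<le> K\<close> by (simp add: field_simps)
  qed (use \<open>0 \<le> K\<close> in simp)
  show ?thesis
  proof (cases "unital TYPE('a)")
    case True
    define e where "e = unit_of TYPE('a)"
    have e: "e * x = x" "x * e = x" for x
      using unital_algebra_unit[OF True] by (auto simp: e_def algebra_unit_def)
    obtain y where y: "y * (a - l *\<^sub>C e) = e"
      using assms True by (auto simp: cstar_spectrum_def invertible_wrt_def e_def)
    have "norm x \<le> norm y * norm (shifted_mult a l x)" for x
    proof -
      have "x = y * shifted_mult a l x"
        using arg_cong[OF y, of "\<lambda>u. u * x"]
        by (simp add: e shifted_mult_def mult.assoc algebra_simps mult_scaleC_left mult_scaleC_right)
      then show ?thesis by (metis norm_mult_ineq)
    qed
    then show ?thesis by (rule *) simp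
  next
    case False
    then obtain y m where "unitization_mult (y, m) ((a, 0) - (0, l)) = (0, 1)"
      using assms by (auto simp: cstar_spectrum_def invertible_wrt_def)
    then have y: "y * a + m *\<^sub>C a - l *\<^sub>C y = 0" and m: "m * l = - 1"
      by (auto simp: algebra_simps eq_neg_iff_add_eq_0 neg_eq_iff_add_eq_0)
    have "norm x \<le> (norm y + cmod m) * norm (shifted_mult a l x)" for x
    proof -
      have "y * shifted_mult a l x + m *\<^sub>C shifted_mult a l x
          = (y * a + m *\<^sub>C a - l *\<^sub>C y) * x - (m * l) *\<^sub>C x"
        by (simp add: shifted_mult_def algebra_simps mult.assoc mult_scaleC_left mult_scaleC_right
            scaleC_diff_right scaleC_scaleC)
      then have "x = y * shifted_mult a l x + m *\<^sub>C shifted_mult a l x"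
        by (simp add: y m)
      then have "norm x \<le> norm (y * shifted_mult a l x) + norm (m *\<^sub>C shifted_mult a l x)"
        by (metis norm_triangle_ineq)
      then show ?thesis
        using norm_mult_ineq[of y "shifted_mult a l x"] by (simp add: norm_scaleC distrib_right)
    qed
    then show ?thesis by (rule *) simp
  qed
qed

text \<open>
  A solution \<open>y\<close> of \<open>(a - l) y = 1\<close> is a right inverse, and injectivity makes it a left inverse. In a
  non-unital algebra \<open>(a - l) b = a\<close> is solved instead: then \<open>(b - 1) / l\<close> is the inverse in the
  unitization. Here \<open>l\<close> cannot vanish, because a solution \<open>e\<close> of \<open>a e = a\<close> would be a unit.
\<close>

lemma bij_shifted_mult_imp_not_in_spectrum:
  fixes a :: "'a::cstar_algebra"
  assumes inj: "\<And>x. shifted_mult a l x = 0 \<Longrightarrow> x = 0"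
    and "surj (shifted_mult a l)"
  shows "l \<notin> cstar_spectrum a"
proof (cases "unital TYPE('a)")
  case True
  define e where "e = unit_of TYPE('a)"
  have e: "e * x = x" "x * e = x" for x
    using unital_algebra_unit[OF True] by (auto simp: e_def algebra_unit_def)
  have T: "(a - l *\<^sub>C e) * x = shifted_mult a l x" for x
    by (simp add: shifted_mult_def algebra_simps mult_scaleC_left e)
  obtain y where y: "(a - l *\<^sub>C e) * y = e"
    using \<open>surj (shifted_mult a l)\<close> by (metis T surj_def)
  have "shifted_mult a l (y * (a - l *\<^sub>C e) - e) = (a - l *\<^sub>C e) * y * (a - l *\<^sub>C e) - (a - l *\<^sub>C e)"
    by (simp add: e right_diff_distrib mult.assoc flip: T)
  also have "\<dots> = 0" by (simp only: y e) simp
  finally have "y * (a - l *\<^sub>C e) = e" using inj by fastforce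
  then show ?thesis
    using True y by (auto simp: cstar_spectrum_def invertible_wrt_def e_def)
next
  case False
  have "l \<noteq> 0"
  proof
    assume "l = 0"
    then have T: "shifted_mult a l x = a * x" for x by (simp add: shifted_mult_def)
    obtain e where "a = shifted_mult a l e"
      using \<open>surj (shifted_mult a l)\<close> by (rule surjE)
    then have e: "a * e = a" by (simp add: T)
    have left: "e * y = y" for y
      using inj[of "e * y - y"] by (simp add: T right_diff_distrib e flip: mult.assoc)
    then have right: "y * star e = y" for y
      by (metis star_mult star_star)
    have "star e = e" by (metis left right)
    then have "algebra_unit e" using left right by (simp add: algebra_unit_def)
    then show False using False by (auto simp: unital_def)
  qed
  obtain b where b: "a = shifted_mult a l b"
    using \<open>surj (shifted_mult a l)\<close> by (rule surjE)
  have ab: "a * b = a + l *\<^sub>C b" using b by (simp add: shifted_mult_def algebra_simps)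
  have "shifted_mult a l (b * a - l *\<^sub>C b - a) = 0"
    by (simp add: shifted_mult_diff shifted_mult_times shifted_mult_scaleC flip: b)
       (simp add: shifted_mult_def)
  from inj[OF this] have ba: "b * a = a + l *\<^sub>C b" by (simp add: algebra_simps)
  define y where "y = inverse l *\<^sub>C b"
  have "unitization_mult ((a, 0) - (0, l)) (y, - inverse l) = (0, 1)"
    "unitization_mult (y, - inverse l) ((a, 0) - (0, l)) = (0, 1)"
    using \<open>l \<noteq> 0\<close> by (simp_all add: y_def mult_scaleC_left mult_scaleC_right ab ba
        scaleC_add_right scaleC_scaleC)
  then have "invertible_wrt unitization_mult (0, 1) ((a, 0) - (0, l))"
    unfolding invertible_wrt_def by blast
  then show ?thesis
    using False by (simp add: cstar_spectrum_def)
qed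

text \<open>
  The spectrum of a normal element is its approximate point spectrum, in one formulation for unital
  and non-unital algebras.
\<close>

theorem in_spectrum_iff:
  assumes "normal_elem a"
  shows "l \<in> cstar_spectrum a \<longleftrightarrow> (\<forall>c>0. \<exists>x. norm (shifted_mult a l x) < c * norm x)"
proof (cases "\<exists>c>0. \<forall>x. c * norm x \<le> norm (shifted_mult a l x)")
  case True
  then obtain c where c: "0 < c" "\<And>x. c * norm x \<le> norm (shifted_mult a l x)" by auto
  have "l \<notin> cstar_spectrum a"
  proof (rule bij_shifted_mult_imp_not_in_spectrum)
    show "x = 0" if "shifted_mult a l x = 0" for x
      using c(2)[of x] c(1) that by (simp add: mult_le_0_iff)
  qed (rule surj_shifted_mult[OF assms c])
  then show ?thesis using True by (auto simp: not_less)
next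
  case False
  then have "l \<in> cstar_spectrum a" using not_in_spectrum_imp_bounded_below[of l a] by blast
  then show ?thesis using False by (auto simp: not_le)
qed

section \<open>The spectrum as a subset of the plane\<close>

lemma not_in_spectrum_nearby:
  assumes "normal_elem a" "0 < c" "\<And>x. c * norm x \<le> norm (shifted_mult a l x)" "cmod (m - l) < c"
  shows "m \<notin> cstar_spectrum a"
proof
  assume "m \<in> cstar_spectrum a"
  then obtain x where x: "norm (shifted_mult a m x) < (c - cmod (m - l)) * norm x"
    using in_spectrum_iff[OF assms(1)] assms(4) by (meson diff_gt_0_iff_gt)
  show False
    using x assms(3)[of x] norm_shifted_mult_shift[of a l x m] by (simp add: algebra_simps)
qed

lemma spectrum_norm_le:
  assumes "normal_elem a" "l \<in> cstar_spectrum a"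
  shows "cmod l \<le> norm a"
proof (rule field_le_epsilon)
  fix \<epsilon> :: real
  assume "0 < \<epsilon>"
  then obtain x where x: "norm (shifted_mult a l x) < \<epsilon> * norm x"
    using assms in_spectrum_iff by blast
  have "cmod l * norm x = norm (a * x - shifted_mult a l x)"
    by (simp add: shifted_mult_def norm_scaleC)
  also have "\<dots> \<le> norm a * norm x + norm (shifted_mult a l x)"
    by (intro order.trans[OF norm_triangle_ineq4] add_right_mono norm_mult_ineq)
  also have "\<dots> \<le> (norm a + \<epsilon>) * norm x" using x by (simp add: distrib_right)
  finally have "cmod l * norm x \<le> (norm a + \<epsilon>) * norm x" .
  moreover have "0 < norm x" using x by (cases "x = 0") auto
  ultimately show "cmod l \<le> norm a + \<epsilon>" by simp
qed

lemma compact_spectrum: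
  assumes "normal_elem a"
  shows "compact (cstar_spectrum a)"
proof -
  have "\<exists>e>0. ball l e \<subseteq> - cstar_spectrum a" if l: "l \<notin> cstar_spectrum a" for l
  proof -
    obtain c where "0 < c" "\<And>x. c * norm x \<le> norm (shifted_mult a l x)"
      using not_in_spectrum_imp_bounded_below[OF l] by blast
    then have "ball l c \<subseteq> - cstar_spectrum a"
      using not_in_spectrum_nearby[OF assms, of c l] by (auto simp: dist_norm norm_minus_commute)
    then show ?thesis using \<open>0 < c\<close> by blast
  qed
  then have "open (- cstar_spectrum a)" by (simp add: open_contains_ball)
  moreover have "bounded (cstar_spectrum a)"
    using spectrum_norm_le[OF assms] by (auto simp: bounded_iff)
  ultimately show ?thesis by (simp add: compact_eq_bounded_closed closed_open)
qed

lemma uniformly_bounded_below: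
  fixes a :: "'a::cstar_algebra"
  assumes "compact K" "K \<inter> cstar_spectrum a = {}"
  obtains \<kappa> where "0 < \<kappa>" "\<And>l x. l \<in> K \<Longrightarrow> \<kappa> * norm x \<le> norm (shifted_mult a l x)"
proof -
  have "\<forall>l\<in>K. \<exists>c>0. \<forall>x. c * norm x \<le> norm (shifted_mult a l x)"
    using assms(2) not_in_spectrum_imp_bounded_below by blast
  then obtain c where c: "\<And>l. l \<in> K \<Longrightarrow> 0 < c l"
    "\<And>l x. l \<in> K \<Longrightarrow> c l * norm x \<le> norm (shifted_mult a l x)" by metis
  have "K \<subseteq> (\<Union>l\<in>K. ball l (c l / 2))" using c(1) by force
  then obtain D where D: "D \<subseteq> K" "finite D" "K \<subseteq> (\<Union>l\<in>D. ball l (c l / 2))"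
    using compactE_image[OF assms(1), of K "\<lambda>l. ball l (c l / 2)"] by auto
  define \<kappa> where "\<kappa> = Min (insert 1 ((\<lambda>l. c l / 2) ` D))"
  show ?thesis
  proof
    show "0 < \<kappa>" unfolding \<kappa>_def using D c(1) by (subst Min_gr_iff) auto
    fix l and x :: 'a
    assume "l \<in> K"
    then obtain m where m: "m \<in> D" "cmod (l - m) < c m / 2"
      using D(3) by (auto simp: dist_norm norm_minus_commute)
    have "\<kappa> \<le> c m / 2" unfolding \<kappa>_def using D(2) m(1) by (intro Min_le) auto
    then have "\<kappa> * norm x \<le> c m / 2 * norm x" by (rule mult_right_mono) simp
    moreover have "cmod (l - m) * norm x \<le> c m / 2 * norm x"
      using m(2) by (intro mult_right_mono) auto
    ultimately show "\<kappa> * norm x \<le> norm (shifted_mult a l x)"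
      using c(2)[of m x] D(1) m(1) norm_shifted_mult_shift[of a m x l]
      by (auto simp: subset_iff)
  qed
qed

section \<open>Approximate eigenvectors and the distance to the spectrum\<close>

lemma sum_roots_of_unity_orthogonal:
  assumes "m < N" "n < N"
  shows "(\<Sum>k<N. cis (2 * pi * real k / N) ^ m * cnj (cis (2 * pi * real k / N)) ^ n)
    = (if m = n then of_nat N else 0)"
proof (cases "m = n")
  case True
  then show ?thesis
    by (simp add: cis_cnj cis_mult flip: power_mult_distrib)
next
  case False
  define z where "z = cis (2 * pi * ((real m - real n) / N))"
  have "0 < N" using assms by simp
  have z_pow: "cis (2 * pi * k / N) ^ m * cnj (cis (2 * pi * k / N)) ^ n = z ^ k" for k :: nat
    using \<open>0 < N\<close> by (simp add: z_def cis_cnj Complex.DeMoivre cis_mult field_simps)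
  have "z ^ N = 1"
  proof -
    have "z ^ N = cis (2 * pi * (real m - real n))"
      using \<open>0 < N\<close> by (simp add: z_def Complex.DeMoivre)
    also have "\<dots> = 1" by (intro cis_multiple_2pi) auto
    finally show ?thesis .
  qed
  have "z \<noteq> 1"
  proof
    assume "z = 1"
    then have "cos (2 * pi * ((real m - real n) / N)) = 1"
      by (simp add: z_def complex_eq_iff)
    then obtain i :: int where "2 * pi * ((real m - real n) / N) = real_of_int i * 2 * pi"
      using cos_one_2pi_int by blast
    then have "2 * pi * ((real m - real n) / N) = 2 * pi * real_of_int i" by simp
    then have "(real m - real n) / N = i" by (subst (asm) mult_cancel_left) simp
    then have "real m - real n = i * N" using \<open>0 < N\<close> by (simp add: field_simps)
    then have "int m - int n = i * int N"
      by (metis of_int_eq_iff of_int_diff of_int_mult of_int_of_nat_eq)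
    moreover have "\<bar>int m - int n\<bar> < int N" using assms by simp
    ultimately have "\<bar>i\<bar> * int N < 1 * int N" by (simp add: abs_mult)
    then have "\<bar>i\<bar> < 1" by (rule mult_right_less_imp_less) simp
    then have "i = 0" by simp
    then show False using \<open>int m - int n = i * int N\<close> False by simp
  qed
  then have "(\<Sum>k<N. z ^ k) = 0"
    using geometric_sum[of z N] \<open>z ^ N = 1\<close> by simp
  then show ?thesis using False by (simp add: z_pow)
qed

text \<open>
  Let \<open>r u\<^sub>n\<^sub>+\<^sub>1 = T u\<^sub>n\<close> with \<open>T = a - l\<close>. For \<open>\<bar>\<omega>\<bar> = 1\<close> the vector
  \<open>v\<^sub>\<omega> = \<Sum>\<^sub>i\<^sub>,\<^sub>j\<^sub><\<^sub>M \<omega>\<^sup>-\<^sup>(\<^sup>i\<^sup>+\<^sup>j\<^sup>) u\<^sub>i\<^sub>+\<^sub>j\<close> telescopes: \<open>(T - r \<omega>)\<^sup>2 v\<^sub>\<omega>\<close> consists of boundary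
  terms only. If \<open>T - r \<omega>\<close> is bounded below on the whole circle, then all \<open>v\<^sub>\<omega>\<close> are bounded
  independently of \<open>M\<close>; but averaging over roots of unity shows that \<open>M u\<^sub>M\<^sub>-\<^sub>1\<close> is a mean of vectors
  of the same norm as the \<open>v\<^sub>\<omega>\<close>.
\<close>

lemma circle_average_bound:
  fixes u :: "nat \<Rightarrow> 'a::cstar_algebra"
  assumes r: "0 < r" and "0 < \<kappa>" and "0 < M"
    and low: "\<And>\<omega> x. cmod \<omega> = 1 \<Longrightarrow> \<kappa> * norm x \<le> norm (shifted_mult a (l + of_real r * \<omega>) x)"
    and u: "\<And>n. shifted_mult a l (u n) = of_real r *\<^sub>C u (Suc n)"
  shows "\<kappa>\<^sup>2 * (M * norm (u (M - 1))) \<le> r\<^sup>2 * (norm (u (2 * M)) + 2 * norm (u M) + norm (u 0))"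
proof -
  define v where "v \<omega> = (\<Sum>j<M. cnj \<omega> ^ j *\<^sub>C (\<Sum>i<M. cnj \<omega> ^ i *\<^sub>C u (i + j)))" for \<omega>
  define K where "K = r\<^sup>2 * (norm (u (2 * M)) + 2 * norm (u M) + norm (u 0))"
  have v_bound: "\<kappa>\<^sup>2 * norm (v \<omega>) \<le> K" if \<omega>: "cmod \<omega> = 1" for \<omega>
  proof -
    let ?E = "shifted_mult a (l + of_real r * \<omega>)"
    have unit: "\<omega> * cnj \<omega> = 1"
      using \<omega> by (metis complex_norm_square of_real_1 power_one)
    have telescope: "?E (\<Sum>j<M. cnj \<omega> ^ j *\<^sub>C w j)
        = (of_real r * \<omega>) *\<^sub>C (cnj \<omega> ^ M *\<^sub>C w M - w 0)"
      if w: "\<And>n. shifted_mult a l (w n) = of_real r *\<^sub>C w (Suc n)" for w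
    proof -
      have "?E (cnj \<omega> ^ j *\<^sub>C w j)
          = (of_real r * \<omega>) *\<^sub>C (cnj \<omega> ^ Suc j *\<^sub>C w (Suc j) - cnj \<omega> ^ j *\<^sub>C w j)" for j
      proof -
        have "of_real r * \<omega> * (cnj \<omega> * cnj \<omega> ^ j) = of_real r * (\<omega> * cnj \<omega>) * cnj \<omega> ^ j"
          by (simp only: mult_ac)
        then have "(of_real r * \<omega> * (cnj \<omega> * cnj \<omega> ^ j)) *\<^sub>C w (Suc j)
            = (of_real r * cnj \<omega> ^ j) *\<^sub>C w (Suc j)"
          by (simp only: unit mult_1_right)
        then show ?thesis
          by (simp add: shifted_mult_scaleC shifted_mult_shift[of a "l + of_real r * \<omega>" "w j" l] w
              scaleC_add_right scaleC_diff_right scaleC_scaleC mult.commute[of "cnj \<omega> ^ j"])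
      qed
      then show ?thesis
        using sum_lessThan_telescope[of "\<lambda>j. cnj \<omega> ^ j *\<^sub>C w j" M]
        by (simp add: shifted_mult_sum flip: scaleC_sum_right)
    qed
    have u_sum: "shifted_mult a l (\<Sum>i<M. cnj \<omega> ^ i *\<^sub>C u (i + n))
        = of_real r *\<^sub>C (\<Sum>i<M. cnj \<omega> ^ i *\<^sub>C u (i + Suc n))" for n
      by (simp add: shifted_mult_sum shifted_mult_scaleC u scaleC_sum_right scaleC_scaleC mult.commute)
    have inner: "?E (\<Sum>i<M. cnj \<omega> ^ i *\<^sub>C u (i + n))
        = (of_real r * \<omega>) *\<^sub>C (cnj \<omega> ^ M *\<^sub>C u (M + n) - u n)" for n
      using telescope[of "\<lambda>i. u (i + n)"] by (simp add: u)
    have Ev: "?E (v \<omega>) = (of_real r * \<omega>) *\<^sub>C (cnj \<omega> ^ M *\<^sub>C (\<Sum>i<M. cnj \<omega> ^ i *\<^sub>C u (i + M))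
        - (\<Sum>i<M. cnj \<omega> ^ i *\<^sub>C u (i + 0)))"
      unfolding v_def
      by (rule telescope[of "\<lambda>n. \<Sum>i<M. cnj \<omega> ^ i *\<^sub>C u (i + n)", OF u_sum])
    have EEv: "?E (?E (v \<omega>)) = (of_real r * \<omega>)\<^sup>2 *\<^sub>C
        (cnj \<omega> ^ M *\<^sub>C (cnj \<omega> ^ M *\<^sub>C u (M + M) - u M) - (cnj \<omega> ^ M *\<^sub>C u M - u 0))"
      unfolding Ev shifted_mult_scaleC shifted_mult_diff inner
      by (simp add: scaleC_scaleC scaleC_diff_right power2_eq_square mult_ac)
    have "\<kappa>\<^sup>2 * norm (v \<omega>) \<le> \<kappa> * norm (?E (v \<omega>))"
      using low[OF \<omega>, of "v \<omega>"] \<open>0 < \<kappa>\<close> by (simp add: power2_eq_square)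
    also have "\<dots> \<le> norm (?E (?E (v \<omega>)))" by (rule low[OF \<omega>])
    also have "\<dots> = r\<^sup>2 * norm
        (cnj \<omega> ^ M *\<^sub>C (cnj \<omega> ^ M *\<^sub>C u (M + M) - u M) - (cnj \<omega> ^ M *\<^sub>C u M - u 0))"
      unfolding EEv by (simp add: norm_scaleC norm_mult norm_power \<omega>)
    also have "\<dots> \<le> K"
    proof -
      have "norm (cnj \<omega> ^ M *\<^sub>C (cnj \<omega> ^ M *\<^sub>C u (M + M) - u M)) \<le> norm (u (2 * M)) + norm (u M)"
        using norm_triangle_ineq4[of "cnj \<omega> ^ M *\<^sub>C u (M + M)" "u M"]
        by (simp add: norm_scaleC norm_power \<omega> mult_2)
      moreover have "norm (cnj \<omega> ^ M *\<^sub>C u M - u 0) \<le> norm (u M) + norm (u 0)"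
        using norm_triangle_ineq4[of "cnj \<omega> ^ M *\<^sub>C u M" "u 0"]
        by (simp add: norm_scaleC norm_power \<omega>)
      ultimately show ?thesis
        unfolding K_def
        by (intro mult_left_mono order.trans[OF norm_triangle_ineq4]) auto
    qed
    finally show ?thesis .
  qed
  define N where "N = 2 * M"
  define \<rho> where "\<rho> k = cis (2 * pi * k / N)" for k :: nat
  have "(\<Sum>k<N. \<rho> k ^ (M - 1) *\<^sub>C v (\<rho> k))
      = (\<Sum>j<M. \<Sum>i<M. (\<Sum>k<N. \<rho> k ^ (M - 1) * cnj (\<rho> k) ^ (i + j)) *\<^sub>C u (i + j))"
    unfolding v_def scaleC_sum_right scaleC_sum_left scaleC_scaleC
    by (subst sum.swap, rule sum.cong[OF refl], subst sum.swap)
       (simp add: power_add mult_ac)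
  also have "\<dots> = (\<Sum>j<M. \<Sum>i<M. if i = M - 1 - j then of_nat N *\<^sub>C u (M - 1) else 0)"
  proof (intro sum.cong refl)
    fix i j assume "i \<in> {..<M}" "j \<in> {..<M}"
    then have "i + j < N" "M - 1 < N" by (auto simp: N_def)
    moreover have "M - 1 = i + j \<longleftrightarrow> i = M - 1 - j" using \<open>j \<in> {..<M}\<close> by auto
    ultimately show "(\<Sum>k<N. \<rho> k ^ (M - 1) * cnj (\<rho> k) ^ (i + j)) *\<^sub>C u (i + j)
        = (if i = M - 1 - j then of_nat N *\<^sub>C u (M - 1) else 0)"
      using sum_roots_of_unity_orthogonal[of "M - 1" N "i + j"] \<open>j \<in> {..<M}\<close> by (auto simp: \<rho>_def)
  qed
  also have "\<dots> = (\<Sum>j<M. of_nat N *\<^sub>C u (M - 1))"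
    using \<open>0 < M\<close> by (intro sum.cong refl) (auto simp: sum.delta)
  finally have "(\<Sum>k<N. \<rho> k ^ (M - 1) *\<^sub>C v (\<rho> k)) = real M *\<^sub>R (of_nat N *\<^sub>C u (M - 1))"
    by (simp add: sum_constant_scaleR)
  then have "\<kappa>\<^sup>2 * (M * (N * norm (u (M - 1)))) = \<kappa>\<^sup>2 * norm (\<Sum>k<N. \<rho> k ^ (M - 1) *\<^sub>C v (\<rho> k))"
    by (simp add: norm_scaleC)
  also have "\<dots> \<le> \<kappa>\<^sup>2 * (\<Sum>k<N. norm (v (\<rho> k)))"
    by (intro mult_left_mono order.trans[OF norm_sum] sum_mono)
       (auto simp: norm_scaleC norm_power \<rho>_def)
  also have "\<dots> \<le> (\<Sum>k<N. K)"
    unfolding sum_distrib_left by (intro sum_mono v_bound) (simp add: \<rho>_def)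
  also have "\<dots> = N * K" by simp
  finally have "N * (\<kappa>\<^sup>2 * (M * norm (u (M - 1)))) \<le> N * K" by (simp add: mult_ac)
  moreover have "0 < N" using \<open>0 < M\<close> by (simp add: N_def)
  ultimately show ?thesis by (simp add: K_def)
qed

text \<open>
  For normal \<open>a\<close> the best lower bound \<open>r\<close> of \<open>T = a - l\<close> is the distance from \<open>l\<close> to the spectrum.
  If the circle of radius \<open>r\<close> missed the spectrum, take a vector \<open>x\<close> at which \<open>r\<close> is almost
  attained and go back along the orbit of \<open>T\<close>, to \<open>y = T\<^sup>-\<^sup>2\<^sup>M x\<close>. Log-convexity keeps every ratio of
  consecutive norms on the way almost equal to \<open>r\<close>, so the rescaled orbit of \<open>y\<close> has almost constant
  norm over \<open>2 M\<close> steps, which contradicts the circle average bound for large \<open>M\<close>.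
\<close>

theorem spectrum_meets_ball:
  assumes a: "normal_elem a" and b0: "norm (shifted_mult a l b0) < \<delta> * norm b0"
  shows "\<exists>m\<in>cstar_spectrum a. cmod (m - l) < \<delta>"
proof (rule ccontr)
  assume "\<not> ?thesis"
  then have far: "m \<notin> cstar_spectrum a" if "cmod (m - l) < \<delta>" for m
    using that by blast
  let ?T = "shifted_mult a l"
  have "0 < norm b0" using b0 by (cases "b0 = 0") auto
  have "0 < \<delta> * norm b0" using b0 by (rule le_less_trans[OF norm_ge_zero])
  then have "0 < \<delta>" using \<open>0 < norm b0\<close> by (simp add: zero_less_mult_iff)
  then obtain c where c: "0 < c" "\<And>x. c * norm x \<le> norm (?T x)"
    using not_in_spectrum_imp_bounded_below[OF far[of l]] by auto
  define Q where "Q = (\<lambda>x. norm (?T x) / norm x) ` (- {0})"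
  define r where "r = Inf Q"
  have Q: "Q \<noteq> {}" "bdd_below Q"
    using \<open>0 < norm b0\<close> by (auto simp: Q_def intro!: bdd_belowI[of _ 0])
  have "c \<le> r"
    unfolding r_def using Q c by (intro cInf_greatest) (auto simp: Q_def field_simps)
  then have "0 < r" using c by simp
  have r_low: "r * norm x \<le> norm (?T x)" for x
  proof (cases "x = 0")
    case False
    then have "r \<le> norm (?T x) / norm x"
      unfolding r_def using Q by (intro cInf_lower) (auto simp: Q_def)
    then show ?thesis using False by (simp add: field_simps)
  qed simp
  have "r * norm b0 < \<delta> * norm b0" using r_low[of b0] b0 by simp
  then have "r < \<delta>" using \<open>0 < norm b0\<close> by simp
  then have "sphere l r \<inter> cstar_spectrum a = {}"
    using far by (auto simp: dist_norm norm_minus_commute)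
  then obtain \<kappa> where \<kappa>: "0 < \<kappa>"
    "\<And>m x. m \<in> sphere l r \<Longrightarrow> \<kappa> * norm x \<le> norm (shifted_mult a m x)"
    using uniformly_bounded_below[OF compact_sphere] by metis
  \<comment> \<open>The four boundary terms of the circle average bound have norm at most \<open>2 \<parallel>u\<^sub>0\<parallel>\<close> each.\<close>
  obtain M where M: "8 * r\<^sup>2 / \<kappa>\<^sup>2 < real M"
    using reals_Archimedean2 by blast
  have "0 < M"
  proof (rule ccontr)
    assume "\<not> 0 < M"
    then show False using M by (simp add: divide_less_0_iff)
  qed
  \<comment> \<open>The tolerance for the ratios of consecutive norms: over \<open>2 M\<close> steps it accumulates to \<open>2\<close>.\<close>
  define q where "q = root (2 * M) 2"
  have q: "1 < q" "q ^ (2 * M) = 2"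
    using \<open>0 < M\<close> by (auto simp: q_def real_root_gt_1_iff real_root_pow_pos2)
  have "Inf Q < r * q" using \<open>0 < r\<close> \<open>1 < q\<close> by (simp add: r_def[symmetric])
  then obtain x where x: "x \<noteq> 0" "norm (?T x) < r * q * norm x"
    using cInf_less_iff[OF Q] by (auto simp: Q_def field_simps)
  have "surj ?T" by (rule surj_shifted_mult[OF a c])
  then have "surj (?T ^^ (2 * M))" by (rule surj_fn)
  then obtain y where y: "(?T ^^ (2 * M)) y = x" by (metis surj_def)
  define u where "u n = of_real ((1 / r) ^ n) *\<^sub>C (?T ^^ n) y" for n
  have norm_u: "norm (u n) = norm ((?T ^^ n) y) / r ^ n" for n
    using \<open>0 < r\<close> by (simp add: u_def norm_scaleC norm_divide norm_power power_divide)
  have u_Suc: "?T (u n) = of_real r *\<^sub>C u (Suc n)" for n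
    using \<open>0 < r\<close> by (simp add: u_def shifted_mult_scaleC scaleC_scaleC)
  have u_mono: "norm (u n) \<le> norm (u (Suc n))" for n
    using r_low[of "u n"] \<open>0 < r\<close> by (simp add: u_Suc norm_scaleC)
  have u_ge: "norm (u 0) \<le> norm (u n)" for n
    by (induction n) (auto intro: order.trans u_mono)
  have u_convex: "(norm (u (Suc n)))\<^sup>2 \<le> norm (u n) * norm (u (Suc (Suc n)))" for n
    using norm_shifted_mult_log_convex[OF a, of l "u n"] \<open>0 < r\<close>
    by (simp add: u_Suc shifted_mult_scaleC norm_scaleC power_mult_distrib power2_eq_square mult_ac)
  have ratio: "norm (u (Suc n)) \<le> q * norm (u n)" if "n \<le> 2 * M" for n
    using that
  proof (induction rule: inc_induct)
    case base
    have "norm (?T ((?T ^^ (2 * M)) y)) \<le> r * q * norm ((?T ^^ (2 * M)) y)"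
      using x(2) by (simp only: y less_imp_le)
    then show ?case using \<open>0 < r\<close> by (simp add: norm_u field_simps)
  next
    case (step n)
    have "norm (u (Suc n)) * norm (u (Suc n)) \<le> norm (u n) * (q * norm (u (Suc n)))"
      using u_convex[of n] mult_left_mono[OF step.IH norm_ge_zero[of "u n"]]
      by (simp add: power2_eq_square)
    then have "norm (u (Suc n)) * norm (u (Suc n)) \<le> (q * norm (u n)) * norm (u (Suc n))"
      by (simp add: mult_ac)
    then show ?case
      using q by (cases "u (Suc n) = 0") auto
  qed
  have "norm (u n) \<le> q ^ n * norm (u 0)" if "n \<le> 2 * M" for n
    using that
  proof (induction n)
    case (Suc n)
    then have "norm (u (Suc n)) \<le> q * norm (u n)" using ratio[of n] by simp
    also have "\<dots> \<le> q * (q ^ n * norm (u 0))"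
      using Suc q by (intro mult_left_mono) auto
    finally have "norm (u (Suc n)) \<le> q * (q ^ n * norm (u 0))" .
    then show ?case by (simp add: mult_ac)
  qed simp
  moreover have "q ^ n \<le> 2" if "n \<le> 2 * M" for n
    using power_increasing[OF that, of q] q by simp
  ultimately have u_le: "norm (u n) \<le> 2 * norm (u 0)" if "n \<le> 2 * M" for n
    using that by (meson mult_right_mono norm_ge_zero order.trans)
  have "y \<noteq> 0"
  proof
    have "(?T ^^ n) 0 = 0" for n by (induction n) auto
    moreover assume "y = 0"
    ultimately show False using x(1) y by simp
  qed
  then have "0 < norm (u 0)" by (simp add: u_def)
  have "\<kappa>\<^sup>2 * (M * norm (u 0)) \<le> \<kappa>\<^sup>2 * (M * norm (u (M - 1)))"
    using u_ge by (intro mult_left_mono) auto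
  also have "\<dots> \<le> r\<^sup>2 * (norm (u (2 * M)) + 2 * norm (u M) + norm (u 0))"
  proof (rule circle_average_bound)
    show "\<kappa> * norm x \<le> norm (shifted_mult a (l + of_real r * \<omega>) x)" if "cmod \<omega> = 1" for \<omega> x
      using that \<open>0 < r\<close> by (intro \<kappa>(2)) (auto simp: dist_norm norm_mult)
  qed (use \<open>0 < r\<close> \<kappa>(1) \<open>0 < M\<close> u_Suc in auto)
  also have "\<dots> \<le> r\<^sup>2 * (8 * norm (u 0))"
    using u_le[of "2 * M"] u_le[of M] norm_ge_zero[of "u 0"]
    by (intro mult_left_mono) (linarith | simp)+
  finally have "(\<kappa>\<^sup>2 * M) * norm (u 0) \<le> (8 * r\<^sup>2) * norm (u 0)" by (simp add: mult_ac)
  then have "\<kappa>\<^sup>2 * M \<le> 8 * r\<^sup>2" using \<open>0 < norm (u 0)\<close> by simp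
  then show False using M \<kappa>(1) by (simp add: field_simps)
qed

text \<open>
  An element \<open>b\<close> that almost solves \<open>(a - l) b = a\<close> keeps the points of the spectrum that are not
  too close to \<open>0\<close> away from \<open>l\<close>: apply the
  adjoint of this equation to an approximate eigenvector of the adjoint of \<open>a\<close>.
\<close>

lemma spectrum_excluded:
  assumes a: "normal_elem a" and m: "m \<in> cstar_spectrum a"
  shows "cmod m \<le> norm (shifted_mult a l b - a) + cmod (m - l) * norm b"
proof (rule field_le_epsilon)
  fix \<epsilon> :: real
  assume "0 < \<epsilon>"
  define e where "e = shifted_mult a l b - a"
  define \<eta> where "\<eta> = \<epsilon> / (norm b + 1)"
  have "0 < \<eta>" using \<open>0 < \<epsilon>\<close> by (simp add: \<eta>_def add_nonneg_pos)
  then obtain x where x: "norm (shifted_mult a m x) < \<eta> * norm x"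
    using m in_spectrum_iff[OF a] by blast
  then have "0 < norm x" by (cases "x = 0") auto
  define s where "s = shifted_mult (star a) (cnj m) x"
  have s: "norm s \<le> \<eta> * norm x"
    using x by (simp add: s_def norm_shifted_mult_star[OF a])
  have "star e * x = star b * (s + (cnj m - cnj l) *\<^sub>C x) - (s + cnj m *\<^sub>C x)"
    by (simp add: e_def star_diff left_diff_distrib star_shifted_mult s_def
        flip: shifted_mult_shift) (simp add: shifted_mult_def)
  then have "cnj m *\<^sub>C x = star b * s - s + cnj (m - l) *\<^sub>C (star b * x) - star e * x"
    by (simp add: distrib_left mult_scaleC_right)
  then have "norm (cnj m *\<^sub>C x)
      \<le> norm (star b * s) + norm s + norm (cnj (m - l) *\<^sub>C (star b * x)) + norm (star e * x)"
    by (smt (verit) norm_triangle_ineq norm_triangle_ineq4)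
  then have "cmod m * norm x
      \<le> norm b * norm s + norm s + cmod (m - l) * (norm b * norm x) + norm e * norm x"
    using norm_mult_ineq[of "star b" s] norm_mult_ineq[of "star e" x]
      mult_left_mono[OF norm_mult_ineq[of "star b" x] norm_ge_zero[of "m - l"]]
    unfolding norm_scaleC complex_mod_cnj norm_star by linarith
  also have "norm b * norm s + norm s = (norm b + 1) * norm s" by (simp add: distrib_right)
  also have "(norm b + 1) * norm s \<le> (norm b + 1) * (\<eta> * norm x)"
    using s by (intro mult_left_mono) auto
  also have "(norm b + 1) * (\<eta> * norm x) = \<epsilon> * norm x"
    by (simp add: \<eta>_def add_nonneg_eq_0_iff)
  finally have "cmod m * norm x \<le> (norm e + cmod (m - l) * norm b + \<epsilon>) * norm x"
    by (simp add: algebra_simps)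
  then show "cmod m \<le> norm (shifted_mult a l b - a) + cmod (m - l) * norm b + \<epsilon>"
    using \<open>0 < norm x\<close> by (simp add: e_def)
qed

section \<open>Closure properties of the recursive functions\<close>

text \<open>
  The predicate \<^const>\<open>recursive\<close> fixes a function also on lists of the wrong length; only the
  values on lists of length \<open>n\<close> matter here.
\<close>

definition computable_nary :: "nat \<Rightarrow> (nat list \<Rightarrow> nat) \<Rightarrow> bool" where
  "computable_nary n F \<longleftrightarrow> (\<exists>f. recursive n f \<and> (\<forall>xs. length xs = n \<longrightarrow> f xs = F xs))"

lemma computable_nary_recursive: "recursive n f \<Longrightarrow> computable_nary n f"
  by (auto simp: computable_nary_def)

lemma computable_nary_cong:
  assumes "computable_nary n F" "\<And>xs. length xs = n \<Longrightarrow> F xs = G xs"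
  shows "computable_nary n G"
  using assms by (auto simp: computable_nary_def)

lemma computable_nary_comp:
  assumes "computable_nary (length hs) g" "\<forall>h\<in>set hs. computable_nary n h"
  shows "computable_nary n (\<lambda>xs. g (map (\<lambda>h. h xs) hs))"
proof -
  obtain g' where g': "recursive (length hs) g'" "\<And>xs. length xs = length hs \<Longrightarrow> g' xs = g xs"
    using assms(1) by (auto simp: computable_nary_def)
  obtain c where c: "\<And>h. h \<in> set hs \<Longrightarrow> recursive n (c h)"
    "\<And>h xs. h \<in> set hs \<Longrightarrow> length xs = n \<Longrightarrow> c h xs = h xs"
    using assms(2) unfolding computable_nary_def by metis
  have "recursive n (\<lambda>xs. g' (map (\<lambda>h. h xs) (map c hs)))"
    using g'(1) c(1) by (intro rec_comp) auto
  moreover have "g' (map (\<lambda>h. h xs) (map c hs)) = g (map (\<lambda>h. h xs) hs)" if "length xs = n" for xs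
  proof -
    have eq: "map (\<lambda>h. h xs) (map c hs) = map (\<lambda>h. h xs) hs" using c(2) that by auto
    show ?thesis unfolding eq by (rule g'(2)) simp
  qed
  ultimately show ?thesis by (auto simp: computable_nary_def)
qed

lemma computable_nary_comp1:
  assumes "computable_nary 1 (\<lambda>ys. g (ys ! 0))" "computable_nary n h"
  shows "computable_nary n (\<lambda>xs. g (h xs))"
  using computable_nary_comp[of "[h]" "\<lambda>ys. g (ys ! 0)" n] assms by simp

lemma computable_nary_comp2:
  assumes "computable_nary 2 (\<lambda>ys. g (ys ! 0) (ys ! 1))" "computable_nary n h" "computable_nary n k"
  shows "computable_nary n (\<lambda>xs. g (h xs) (k xs))"
  using computable_nary_comp[of "[h, k]" "\<lambda>ys. g (ys ! 0) (ys ! 1)" n] assms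
  by (simp add: numeral_2_eq_2)

lemma computable_nary_nth: "i < n \<Longrightarrow> computable_nary n (\<lambda>xs. xs ! i)"
  by (intro computable_nary_recursive rec_proj)

lemma computable_nary_Suc: "computable_nary n h \<Longrightarrow> computable_nary n (\<lambda>xs. Suc (h xs))"
  by (rule computable_nary_comp1[OF computable_nary_recursive[OF rec_suc]])

lemma computable_nary_zero: "computable_nary n (\<lambda>_. 0)"
  by (intro computable_nary_recursive rec_zero)

lemma computable_nary_prim:
  assumes "computable_nary n f" "computable_nary (Suc (Suc n)) g"
  shows "computable_nary (Suc n) (\<lambda>xs. rec_nat (f (tl xs)) (\<lambda>k r. g (k # r # tl xs)) (hd xs))"
proof -
  obtain f' g' where *: "recursive n f'" "\<And>xs. length xs = n \<Longrightarrow> f' xs = f xs"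
    "recursive (Suc (Suc n)) g'" "\<And>xs. length xs = Suc (Suc n) \<Longrightarrow> g' xs = g xs"
    using assms by (auto simp: computable_nary_def)
  then show ?thesis
    using rec_prim[OF *(1,3)] by (force simp: computable_nary_def)
qed

lemma computable_nary_least:
  assumes "computable_nary (Suc n) f" "\<And>xs. length xs = n \<Longrightarrow> \<exists>y. f (y # xs) = 0"
  shows "computable_nary n (\<lambda>xs. LEAST y. f (y # xs) = 0)"
proof -
  obtain f' where *: "recursive (Suc n) f'" "\<And>xs. length xs = Suc n \<Longrightarrow> f' xs = f xs"
    using assms by (auto simp: computable_nary_def)
  then show ?thesis
    using rec_mu[OF *(1)] assms(2) by (force simp: computable_nary_def)
qed

lemma computable_nary_rec2:
  assumes "computable_nary 1 (\<lambda>ys. f (ys ! 0))"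
    "computable_nary 3 (\<lambda>zs. g (zs ! 0) (zs ! 1) (zs ! 2))"
    "computable_nary n h" "computable_nary n k"
  shows "computable_nary n (\<lambda>xs. rec_nat (f (k xs)) (\<lambda>i r. g i r (k xs)) (h xs))"
proof (rule computable_nary_comp2[OF _ assms(3,4)])
  have "computable_nary (Suc (Suc 1)) (\<lambda>zs. g (zs ! 0) (zs ! 1) (zs ! 2))"
    using assms(2) by (simp add: numeral_3_eq_3)
  from computable_nary_prim[OF assms(1) this]
  have "computable_nary (Suc 1) (\<lambda>ys. rec_nat (f (ys ! 1)) (\<lambda>i r. g i r (ys ! 1)) (ys ! 0))"
    by (rule computable_nary_cong) (auto simp: length_Suc_conv numeral_2_eq_2)
  then show "computable_nary 2 (\<lambda>ys. rec_nat (f (ys ! 1)) (\<lambda>i r. g i r (ys ! 1)) (ys ! 0))"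
    by (simp only: Suc_1)
qed

lemma computable_nary_add:
  "computable_nary n h \<Longrightarrow> computable_nary n k \<Longrightarrow> computable_nary n (\<lambda>xs. h xs + k xs)"
proof -
  have "rec_nat y (\<lambda>i. Suc) x = x + y" for x y :: nat by (induction x) auto
  then show "computable_nary n h \<Longrightarrow> computable_nary n k \<Longrightarrow> computable_nary n (\<lambda>xs. h xs + k xs)"
    using computable_nary_rec2[of "\<lambda>y. y" "\<lambda>i r y. Suc r" n h k]
    by (simp add: computable_nary_nth computable_nary_Suc)
qed

lemma computable_nary_diff:
  assumes "computable_nary n h" "computable_nary n k"
  shows "computable_nary n (\<lambda>xs. k xs - h xs)"
proof -
  have pred: "computable_nary m (\<lambda>xs. p xs - 1)" if "computable_nary m p" for m p
  proof -
    have "rec_nat 0 (\<lambda>i r. i) x = x - 1" for x :: nat by (cases x) auto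
    then show ?thesis
      using computable_nary_rec2[of "\<lambda>y. 0" "\<lambda>i r y. i" m p p] that
      by (simp add: computable_nary_nth computable_nary_zero)
  qed
  have "rec_nat y (\<lambda>i r. r - 1) x = y - x" for x y :: nat by (induction x) auto
  then show ?thesis
    using computable_nary_rec2[of "\<lambda>y. y" "\<lambda>i r y. r - 1" n h k] assms
    by (simp add: computable_nary_nth pred del: One_nat_def)
qed

lemma computable_nary_triangle: "computable_nary n h \<Longrightarrow> computable_nary n (\<lambda>xs. triangle (h xs))"
proof -
  have "rec_nat 0 (\<lambda>i r. r + Suc i) x = triangle x" for x by (induction x) auto
  then show "computable_nary n h \<Longrightarrow> computable_nary n (\<lambda>xs. triangle (h xs))"
    using computable_nary_rec2[of "\<lambda>y. 0" "\<lambda>i r y. r + Suc i" n h h]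
    by (simp add: computable_nary_nth computable_nary_zero computable_nary_add computable_nary_Suc)
qed

section \<open>Unary computable functions with pairing\<close>

definition ppair :: "nat \<Rightarrow> nat \<Rightarrow> nat" where "ppair x y = prod_encode (x, y)"
definition pfst :: "nat \<Rightarrow> nat" where "pfst n = fst (prod_decode n)"
definition psnd :: "nat \<Rightarrow> nat" where "psnd n = snd (prod_decode n)"

lemma pfst_ppair [simp]: "pfst (ppair x y) = x" and psnd_ppair [simp]: "psnd (ppair x y) = y"
  by (simp_all add: ppair_def pfst_def psnd_def)

lemma prod_decode_eq_pair: "prod_decode n = (pfst n, psnd n)"
  by (simp add: pfst_def psnd_def)

text \<open>
  A function of several variables is treated as a function of one environment variable, into which
  the bound variables of recursions and searches are paired.
\<close>

definition computable_fun :: "(nat \<Rightarrow> nat) \<Rightarrow> bool" where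
  "computable_fun F \<longleftrightarrow> computable_nary 1 (\<lambda>xs. F (xs ! 0))"

definition decidable_pred :: "(nat \<Rightarrow> bool) \<Rightarrow> bool" where
  "decidable_pred P \<longleftrightarrow> computable_fun (\<lambda>e. if P e then 1 else 0)"

named_theorems computable_intros

lemma computable_fun_imp_recursive:
  assumes "computable_fun F"
  shows "\<exists>f. recursive 1 f \<and> (\<forall>x. f [x] = F x)"
  using assms by (force simp: computable_fun_def computable_nary_def)

lemma recursive_imp_computable_fun:
  assumes "recursive 1 f"
  shows "computable_fun (\<lambda>x. f [x])"
  unfolding computable_fun_def
  by (rule computable_nary_cong[OF computable_nary_recursive[OF assms]]) (auto simp: length_Suc_conv)

lemma computable_fun_comp:
  "computable_fun F \<Longrightarrow> computable_fun G \<Longrightarrow> computable_fun (\<lambda>e. F (G e))"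
  unfolding computable_fun_def by (rule computable_nary_comp1)

lemma decidable_pred_comp:
  "decidable_pred P \<Longrightarrow> computable_fun G \<Longrightarrow> decidable_pred (\<lambda>e. P (G e))"
  unfolding decidable_pred_def by (rule computable_fun_comp)

lemma computable_fun_id [computable_intros]: "computable_fun (\<lambda>e. e)"
  by (simp add: computable_fun_def computable_nary_nth)

lemma computable_fun_const [computable_intros]: "computable_fun (\<lambda>e. c)"
  unfolding computable_fun_def
  by (induction c) (simp_all add: computable_nary_zero computable_nary_Suc)

lemma computable_fun_Suc [computable_intros]:
  "computable_fun F \<Longrightarrow> computable_fun (\<lambda>e. Suc (F e))"
  unfolding computable_fun_def by (rule computable_nary_Suc)

lemma computable_fun_add [computable_intros]:
  "computable_fun F \<Longrightarrow> computable_fun G \<Longrightarrow> computable_fun (\<lambda>e. F e + G e)"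
  unfolding computable_fun_def by (rule computable_nary_add)

lemma computable_fun_diff [computable_intros]:
  "computable_fun F \<Longrightarrow> computable_fun G \<Longrightarrow> computable_fun (\<lambda>e. F e - G e)"
  unfolding computable_fun_def by (rule computable_nary_diff)

lemma computable_nary_ppair:
  "computable_nary n h \<Longrightarrow> computable_nary n k \<Longrightarrow> computable_nary n (\<lambda>xs. ppair (h xs) (k xs))"
  by (simp add: ppair_def prod_encode_def computable_nary_add computable_nary_triangle)

lemma computable_fun_ppair [computable_intros]:
  "computable_fun F \<Longrightarrow> computable_fun G \<Longrightarrow> computable_fun (\<lambda>e. ppair (F e) (G e))"
  unfolding computable_fun_def by (rule computable_nary_ppair)

text \<open>
  The sum of the two components of the pair coded by \<open>n\<close> is the index of the last triangle number
  below \<open>n\<close>.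
\<close>

lemma triangle_root:
  defines "k n \<equiv> LEAST k. Suc n - triangle (Suc k) = 0"
  shows "pfst n = n - triangle (k n)" "psnd n = k n - pfst n"
proof -
  define s where "s = pfst n + psnd n"
  have n: "n = triangle s + pfst n"
    using prod_decode_inverse[of n] by (simp add: prod_decode_eq_pair prod_encode_def s_def)
  have below: "triangle s \<le> n" and above: "n \<le> triangle s + s"
    using n s_def by linarith+
  have mono: "triangle i \<le> triangle j" if "i \<le> j" for i j
    using that by (induction rule: dec_induct) auto
  have k: "k n = s"
    unfolding k_def
  proof (rule Least_equality)
    show "Suc n - triangle (Suc s) = 0" using above by simp
    show "s \<le> j" if "Suc n - triangle (Suc j) = 0" for j
    proof (rule ccontr)
      assume "\<not> s \<le> j"
      then have "triangle (Suc j) \<le> n" using mono[of "Suc j" s] below by linarith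
      then show False using that by simp
    qed
  qed
  show "pfst n = n - triangle (k n)" "psnd n = k n - pfst n"
    unfolding k using n s_def by linarith+
qed

lemma computable_fun_pfst [computable_intros]:
    "computable_fun F \<Longrightarrow> computable_fun (\<lambda>e. pfst (F e))"
  and computable_fun_psnd [computable_intros]:
    "computable_fun F \<Longrightarrow> computable_fun (\<lambda>e. psnd (F e))"
proof -
  define k where "k n = (LEAST k. Suc n - triangle (Suc k) = 0)" for n
  have "i \<le> triangle i" for i by (induction i) auto
  then have ex: "\<exists>y. Suc n - triangle (Suc y) = 0" for n
    by (intro exI[of _ n]) (simp add: trans_le_add1)
  have "computable_nary (Suc 1) (\<lambda>xs. Suc (xs ! 1) - triangle (Suc (xs ! 0)))"
    by (intro computable_nary_diff computable_nary_triangle computable_nary_Suc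
        computable_nary_nth) auto
  from computable_nary_least[OF this] ex have k: "computable_fun k"
    unfolding computable_fun_def k_def by simp
  have tri: "computable_fun (\<lambda>e. triangle (G e))" if "computable_fun G" for G
    using that unfolding computable_fun_def by (rule computable_nary_triangle)
  have "pfst = (\<lambda>n. n - triangle (k n))"
    unfolding k_def by (rule ext, rule triangle_root(1))
  then have 1: "computable_fun pfst"
    using computable_fun_diff[OF computable_fun_id tri[OF k]] by simp
  have "psnd = (\<lambda>n. k n - pfst n)"
    unfolding k_def by (rule ext, rule triangle_root(2))
  then have 2: "computable_fun psnd"
    using computable_fun_diff[OF k 1] by simp
  show "computable_fun F \<Longrightarrow> computable_fun (\<lambda>e. pfst (F e))"
    and "computable_fun F \<Longrightarrow> computable_fun (\<lambda>e. psnd (F e))"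
    by (rule computable_fun_comp[OF 1], assumption) (rule computable_fun_comp[OF 2], assumption)
qed

lemma computable_fun_recursive2:
  assumes "recursive 2 f" "computable_fun F" "computable_fun G"
  shows "computable_fun (\<lambda>e. f [F e, G e])"
proof -
  have "computable_nary 2 (\<lambda>ys. f [ys ! 0, ys ! 1])"
    by (rule computable_nary_cong[OF computable_nary_recursive[OF assms(1)]])
      (auto simp: length_Suc_conv numeral_2_eq_2)
  from computable_nary_comp2[of "\<lambda>x y. f [x, y]", OF this assms(2,3)[unfolded computable_fun_def]]
  show ?thesis by (simp only: computable_fun_def)
qed

text \<open>
  In a premise for the body of a recursion, search or fold, the bound variables are the first
  components of a tuple whose last component is the old environment.
\<close>

lemma computable_fun_rec_nat [computable_intros]:
  assumes "computable_fun F"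
    and G: "computable_fun (\<lambda>t. G (pfst t) (pfst (psnd t)) (psnd (psnd t)))"
    and "computable_fun H"
  shows "computable_fun (\<lambda>e. rec_nat (F e) (\<lambda>k r. G k r e) (H e))"
proof -
  have "computable_nary 3 (\<lambda>zs. G (zs ! 0) (zs ! 1) (zs ! 2))"
    using computable_nary_comp1[OF G[unfolded computable_fun_def],
        of 3 "\<lambda>zs. ppair (zs ! 0) (ppair (zs ! 1) (zs ! 2))"]
    by (simp add: computable_nary_ppair computable_nary_nth)
  from computable_nary_rec2[of F G, OF assms(1)[unfolded computable_fun_def] this
      assms(3)[unfolded computable_fun_def], of "\<lambda>xs. xs ! 0"]
  show ?thesis by (simp add: computable_fun_def computable_nary_nth)
qed

lemma computable_fun_If [computable_intros]:
  assumes "decidable_pred P" "computable_fun F" "computable_fun G"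
  shows "computable_fun (\<lambda>e. if P e then F e else G e)"
proof -
  have "(if P e then F e else G e) = rec_nat (G e) (\<lambda>k r. F e) (if P e then 1 else 0)" for e
    by simp
  moreover have "computable_fun (\<lambda>e. rec_nat (G e) (\<lambda>k r. F e) (if P e then 1 else 0))"
    using assms(1)[unfolded decidable_pred_def]
    by (intro computable_fun_rec_nat computable_fun_comp[OF assms(2)] computable_intros assms)
  ultimately show ?thesis by simp
qed

lemma decidable_eq_0: "computable_fun F \<Longrightarrow> decidable_pred (\<lambda>e. F e = 0)"
proof -
  have "(if F e = 0 then 1 else 0) = 1 - F e" for e by simp
  then show "computable_fun F \<Longrightarrow> decidable_pred (\<lambda>e. F e = 0)"
    unfolding decidable_pred_def by (simp only: computable_fun_diff computable_fun_const)
qed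

lemma decidable_not [computable_intros]: "decidable_pred P \<Longrightarrow> decidable_pred (\<lambda>e. \<not> P e)"
proof -
  have "(if \<not> P e then 1 else 0) = 1 - (if P e then 1 else (0::nat))" for e by simp
  then show "decidable_pred P \<Longrightarrow> decidable_pred (\<lambda>e. \<not> P e)"
    unfolding decidable_pred_def by (simp only: computable_fun_diff computable_fun_const)
qed

lemma decidable_conj [computable_intros]:
  assumes "decidable_pred P" "decidable_pred Q"
  shows "decidable_pred (\<lambda>e. P e \<and> Q e)"
proof -
  have "(if P e \<and> Q e then 1 else 0) = (if P e then if Q e then 1 else 0 else (0::nat))" for e
    by simp
  moreover have "computable_fun (\<lambda>e. if P e then if Q e then 1 else 0 else 0)"
    by (intro computable_fun_If computable_fun_const assms)
  ultimately show ?thesis unfolding decidable_pred_def by (simp only:)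
qed

lemma decidable_le [computable_intros]:
  "computable_fun F \<Longrightarrow> computable_fun G \<Longrightarrow> decidable_pred (\<lambda>e. F e \<le> G e)"
  using decidable_eq_0[of "\<lambda>e. F e - G e"] by (simp add: computable_fun_diff)

lemma decidable_less [computable_intros]:
  "computable_fun F \<Longrightarrow> computable_fun G \<Longrightarrow> decidable_pred (\<lambda>e. F e < G e)"
  using decidable_le[of "\<lambda>e. Suc (F e)" G] by (simp add: computable_fun_Suc Suc_le_eq)

lemma decidable_eq [computable_intros]:
  assumes "computable_fun F" "computable_fun G"
  shows "decidable_pred (\<lambda>e. F e = G e)"
proof -
  have "F e = G e \<longleftrightarrow> F e \<le> G e \<and> G e \<le> F e" for e by auto
  moreover have "decidable_pred (\<lambda>e. F e \<le> G e \<and> G e \<le> F e)"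
    by (intro decidable_conj decidable_le assms)
  ultimately show ?thesis by (simp only:)
qed

lemma computable_fun_Least:
  assumes P: "decidable_pred (\<lambda>t. P (pfst t) (psnd t))" and ex: "\<And>e. \<exists>y. P y e"
  shows "computable_fun (\<lambda>e. LEAST y. P y e)"
proof -
  define p where "p y e = (if P y e then 0 else (1::nat))" for y e
  have "computable_fun (\<lambda>t. p (pfst t) (psnd t))"
    unfolding p_def by (intro computable_fun_If P computable_fun_const)
  then have "computable_nary (Suc 1) (\<lambda>xs. p (xs ! 0) (xs ! 1))"
    unfolding computable_fun_def
    using computable_nary_comp1[of "\<lambda>t. p (pfst t) (psnd t)" "Suc 1" "\<lambda>xs. ppair (xs ! 0) (xs ! 1)"]
    by (simp add: computable_nary_ppair computable_nary_nth)
  from computable_nary_least[OF this] have "computable_fun (\<lambda>e. LEAST y. p y e = 0)"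
    unfolding computable_fun_def using ex by (auto simp: p_def)
  moreover have "p y e = 0 \<longleftrightarrow> P y e" for y e by (simp add: p_def)
  ultimately show ?thesis by simp
qed

lemma computable_fun_mult [computable_intros]:
  assumes "computable_fun F" "computable_fun G"
  shows "computable_fun (\<lambda>e. F e * G e)"
proof -
  have "rec_nat 0 (\<lambda>k r. r + y) x = x * y" for x y :: nat by (induction x) auto
  moreover have "computable_fun (\<lambda>e. rec_nat 0 (\<lambda>k r. r + G e) (F e))"
    by (intro computable_fun_rec_nat computable_fun_comp[OF assms(2)] computable_intros assms)
  ultimately show ?thesis by simp
qed

lemma computable_fun_power2 [computable_intros]:
  assumes "computable_fun F"
  shows "computable_fun (\<lambda>e. 2 ^ F e)"
proof -
  have "rec_nat 1 (\<lambda>k r. r + r) x = (2::nat) ^ x" for x :: nat by (induction x) auto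
  moreover have "computable_fun (\<lambda>e. rec_nat 1 (\<lambda>k r. r + r) (F e))"
    by (intro computable_intros assms)
  ultimately show ?thesis by (simp del: One_nat_def)
qed

lemma computable_fun_half [computable_intros]:
  assumes "computable_fun F"
  shows "computable_fun (\<lambda>e. F e div 2)"
proof -
  have "x div 2 = (LEAST y. x < Suc (Suc (y + y)))" for x :: nat
    by (rule Least_equality[symmetric]) auto
  moreover have "computable_fun (\<lambda>e. LEAST y. F e < Suc (Suc (y + y)))"
  proof (rule computable_fun_Least)
    show "decidable_pred (\<lambda>t. F (psnd t) < Suc (Suc (pfst t + pfst t)))"
      by (intro computable_fun_comp[OF assms] computable_intros)
    show "\<exists>y. F e < Suc (Suc (y + y))" for e by (rule exI[of _ "F e"]) simp
  qed
  ultimately show ?thesis by simp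
qed

lemma decidable_even [computable_intros]:
  assumes "computable_fun F"
  shows "decidable_pred (\<lambda>e. even (F e))"
proof -
  have "even x \<longleftrightarrow> x div 2 + x div 2 = x" for x :: nat by presburger
  moreover have "decidable_pred (\<lambda>e. F e div 2 + F e div 2 = F e)"
    by (intro computable_intros assms)
  ultimately show ?thesis by (simp only:)
qed

section \<open>Recursion over coded lists\<close>

lemma list_decode_Suc: "list_decode (Suc n) = pfst n # list_decode (psnd n)"
  by (simp add: prod_decode_eq_pair)

text \<open>The library's equation would split pairs by a case distinction.\<close>

declare list_decode.simps(2) [simp del]

lemma list_decode_cons [simp]: "list_decode (Suc (ppair x l)) = x # list_decode l"
  by (simp add: list_decode_Suc)

lemma length_list_decode_le: "length (list_decode n) \<le> n"
proof (induction n rule: less_induct)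
  case (less n)
  show ?case
  proof (cases n)
    case (Suc m)
    have "psnd m \<le> m"
      using le_prod_encode_2[of "psnd m" "pfst m"] by (metis prod_decode_eq_pair prod_decode_inverse)
    then show ?thesis
      using less[of "psnd m"] Suc by (simp add: list_decode_Suc)
  qed simp
qed

text \<open>
  The state of the recursion is the pair of the remaining list and the accumulator. The code of a
  list bounds its length, so iterating as often as the code says consumes the whole list; the
  remaining steps leave the state unchanged.
\<close>

lemma computable_fun_foldl [computable_intros]:
  assumes S: "computable_fun (\<lambda>t. S (pfst t) (pfst (psnd t)) (psnd (psnd t)))"
    and Init: "computable_fun Init" and L: "computable_fun L"
  shows "computable_fun (\<lambda>e. foldl (\<lambda>acc x. S x acc e) (Init e) (list_decode (L e)))"
proof -
  define step where "step s e = (if pfst s = 0 then s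
    else ppair (psnd (pfst s - 1)) (S (pfst (pfst s - 1)) (psnd s) e))" for s e
  have fold: "psnd (((\<lambda>s. step s e) ^^ n) (ppair l i)) = foldl (\<lambda>acc x. S x acc e) i (list_decode l)"
    if "length (list_decode l) \<le> n" for n l i e
    using that
  proof (induction n arbitrary: l i)
    case 0
    then have "list_decode l = []" by simp
    then show ?case by simp
  next
    case (Suc n)
    show ?case
    proof (cases l)
      case 0
      then have "step (ppair l i) e = ppair l i" by (simp add: step_def)
      then show ?thesis using Suc.IH[of l i] 0 by (simp add: funpow_Suc_right del: funpow.simps)
    next
      case (Suc m)
      then have "step (ppair l i) e = ppair (psnd m) (S (pfst m) i e)" by (simp add: step_def)
      moreover have "length (list_decode (psnd m)) \<le> n"
        using Suc.prems Suc by (simp add: list_decode_Suc)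
      ultimately show ?thesis
        using Suc.IH[of "psnd m" "S (pfst m) i e"] Suc
        by (simp add: funpow_Suc_right list_decode_Suc del: funpow.simps)
    qed
  qed
  have iter: "rec_nat s (\<lambda>k r. step r e) n = ((\<lambda>s. step s e) ^^ n) s" for n s e
    by (induction n) auto
  have S': "computable_fun (\<lambda>t. S (A t) (B t) (D t))"
    if "computable_fun A" "computable_fun B" "computable_fun D" for A B D
    using computable_fun_comp[OF S, of "\<lambda>t. ppair (A t) (ppair (B t) (D t))"] that
    by (simp add: computable_fun_ppair)
  have "computable_fun (\<lambda>e. psnd (rec_nat (ppair (L e) (Init e)) (\<lambda>k r. step r e) (L e)))"
    unfolding step_def
    by (intro S' computable_intros Init L)
  then show ?thesis
    by (simp add: iter fold length_list_decode_le)
qed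

lemma decidable_list_all:
  assumes P: "decidable_pred (\<lambda>t. P (pfst t) (psnd t))" and L: "computable_fun L"
  shows "decidable_pred (\<lambda>e. \<forall>x\<in>set (list_decode (L e)). P x e)"
proof -
  have *: "foldl (\<lambda>acc x. if P x e then acc else 0) i xs = (if \<forall>x\<in>set xs. P x e then i else 0)"
    for e and i :: nat and xs
    by (induction xs arbitrary: i) auto
  have "decidable_pred (\<lambda>t. P (pfst (ppair (pfst t) (psnd (psnd t))))
      (psnd (ppair (pfst t) (psnd (psnd t)))))"
    by (rule decidable_pred_comp[OF P]) (intro computable_intros)
  then have P': "decidable_pred (\<lambda>t. P (pfst t) (psnd (psnd t)))" by simp
  have "computable_fun (\<lambda>e. foldl (\<lambda>acc x. if P x e then acc else 0) 1 (list_decode (L e)))"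
    by (intro computable_intros L P')
  then show ?thesis by (simp add: * decidable_pred_def del: One_nat_def)
qed

section \<open>Arithmetic on codes of rational and Gaussian rational numbers\<close>

text \<open>
  Even numbers code the nonnegative and odd numbers the negative integers. An integer is handled as
  the difference of two natural numbers.
\<close>

definition int_plus_part :: "nat \<Rightarrow> nat" where
  "int_plus_part n = (if even n then n div 2 else 0)"

definition int_minus_part :: "nat \<Rightarrow> nat" where
  "int_minus_part n = (if even n then 0 else Suc (n div 2))"

definition int_code_diff :: "nat \<Rightarrow> nat \<Rightarrow> nat" where
  "int_code_diff p m = (if m \<le> p then 2 * (p - m) else Suc (2 * (m - p - 1)))"

definition int_code_plus :: "nat \<Rightarrow> nat \<Rightarrow> nat" where
  "int_code_plus x y = int_code_diff (int_plus_part x + int_plus_part y)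
     (int_minus_part x + int_minus_part y)"

definition int_code_times :: "nat \<Rightarrow> nat \<Rightarrow> nat" where
  "int_code_times x y = int_code_diff
     (int_plus_part x * int_plus_part y + int_minus_part x * int_minus_part y)
     (int_plus_part x * int_minus_part y + int_minus_part x * int_plus_part y)"

lemma int_decode_parts: "int_decode n = int (int_plus_part n) - int (int_minus_part n)"
  by (simp add: int_decode_def sum_decode_def int_plus_part_def int_minus_part_def)

lemma int_decode_code_diff [simp]: "int_decode (int_code_diff p m) = int p - int m"
  by (auto simp: int_decode_def sum_decode_def int_code_diff_def)

lemma int_decode_code_plus [simp]: "int_decode (int_code_plus x y) = int_decode x + int_decode y"
  by (simp add: int_code_plus_def int_decode_parts[of x] int_decode_parts[of y])

lemma int_decode_code_times [simp]: "int_decode (int_code_times x y) = int_decode x * int_decode y"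
  by (simp add: int_code_times_def int_decode_parts[of x] int_decode_parts[of y] algebra_simps)

lemma int_decode_eq_0_iff: "int_decode n = 0 \<longleftrightarrow> n = 0"
  by (auto simp: int_decode_def sum_decode_def odd_pos split: if_splits)

lemma int_decode_pos_iff: "0 < int_decode n \<longleftrightarrow> even n \<and> \<not> n = 0"
  by (auto simp: int_decode_def sum_decode_def)

lemma computable_fun_int_code_diff [computable_intros]:
  "computable_fun F \<Longrightarrow> computable_fun G \<Longrightarrow> computable_fun (\<lambda>e. int_code_diff (F e) (G e))"
  unfolding int_code_diff_def by (intro computable_intros)

lemma computable_fun_int_code_plus [computable_intros]:
  "computable_fun F \<Longrightarrow> computable_fun G \<Longrightarrow> computable_fun (\<lambda>e. int_code_plus (F e) (G e))"
  unfolding int_code_plus_def int_plus_part_def int_minus_part_def by (intro computable_intros)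

lemma computable_fun_int_code_times [computable_intros]:
  "computable_fun F \<Longrightarrow> computable_fun G \<Longrightarrow> computable_fun (\<lambda>e. int_code_times (F e) (G e))"
  unfolding int_code_times_def int_plus_part_def int_minus_part_def by (intro computable_intros)

definition rat_value :: "nat \<Rightarrow> real" where
  "rat_value n = of_rat (nat_to_rat_surj n)"

lemma rat_value_eq: "rat_value n = of_int (int_decode (pfst n)) / of_int (int_decode (psnd n))"
proof (cases "int_decode (psnd n) = 0")
  case True
  then show ?thesis
    by (simp add: rat_value_def nat_to_rat_surj_def prod_decode_eq_pair rat_number_collapse)
next
  case False
  then show ?thesis
    by (simp add: rat_value_def nat_to_rat_surj_def prod_decode_eq_pair of_rat_rat)
qed

text \<open>
  The coding of the rationals admits the denominator \<open>0\<close>, and a fraction with that denominator has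
  the value \<open>0\<close>; addition must treat it separately.
\<close>

definition rat_code_plus :: "nat \<Rightarrow> nat \<Rightarrow> nat" where
  "rat_code_plus x y = (if psnd x = 0 then y else if psnd y = 0 then x else
     ppair (int_code_plus (int_code_times (pfst x) (psnd y)) (int_code_times (pfst y) (psnd x)))
       (int_code_times (psnd x) (psnd y)))"

definition rat_code_times :: "nat \<Rightarrow> nat \<Rightarrow> nat" where
  "rat_code_times x y =
     ppair (int_code_times (pfst x) (pfst y)) (int_code_times (psnd x) (psnd y))"

definition rat_code_dyadic :: "nat \<Rightarrow> nat \<Rightarrow> nat \<Rightarrow> nat" where
  "rat_code_dyadic p m h = ppair (int_code_diff p m) (int_code_diff (2 ^ h) 0)"

lemma rat_value_plus [simp]: "rat_value (rat_code_plus x y) = rat_value x + rat_value y"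
  by (auto simp: rat_code_plus_def rat_value_eq int_decode_eq_0_iff add_frac_eq)

lemma rat_value_times [simp]: "rat_value (rat_code_times x y) = rat_value x * rat_value y"
  by (simp add: rat_code_times_def rat_value_eq)

lemma rat_value_dyadic [simp]: "rat_value (rat_code_dyadic p m h) = (real p - real m) / 2 ^ h"
  by (simp add: rat_code_dyadic_def rat_value_eq)

lemma rat_value_pos_iff:
  "0 < rat_value n \<longleftrightarrow> 0 < int_decode (int_code_times (pfst n) (psnd n))"
  by (simp add: rat_value_eq zero_less_divide_iff zero_less_mult_iff)

lemma computable_fun_rat_code_plus [computable_intros]:
  "computable_fun F \<Longrightarrow> computable_fun G \<Longrightarrow> computable_fun (\<lambda>e. rat_code_plus (F e) (G e))"
  unfolding rat_code_plus_def by (intro computable_intros)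

lemma computable_fun_rat_code_times [computable_intros]:
  "computable_fun F \<Longrightarrow> computable_fun G \<Longrightarrow> computable_fun (\<lambda>e. rat_code_times (F e) (G e))"
  unfolding rat_code_times_def by (intro computable_intros)

lemma computable_fun_rat_code_dyadic [computable_intros]:
  "computable_fun F \<Longrightarrow> computable_fun G \<Longrightarrow> computable_fun H \<Longrightarrow>
    computable_fun (\<lambda>e. rat_code_dyadic (F e) (G e) (H e))"
  unfolding rat_code_dyadic_def by (intro computable_intros)

lemma decidable_rat_value_pos [computable_intros]:
  "computable_fun F \<Longrightarrow> decidable_pred (\<lambda>e. 0 < rat_value (F e))"
  unfolding rat_value_pos_iff int_decode_pos_iff by (intro computable_intros)

definition gauss_code_times :: "nat \<Rightarrow> nat \<Rightarrow> nat" where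
  "gauss_code_times x y = ppair
     (rat_code_plus (rat_code_times (pfst x) (pfst y))
       (rat_code_times (rat_code_dyadic 0 1 0) (rat_code_times (psnd x) (psnd y))))
     (rat_code_plus (rat_code_times (pfst x) (psnd y)) (rat_code_times (psnd x) (pfst y)))"

definition gauss_code_minus_one :: nat where
  "gauss_code_minus_one = ppair (rat_code_dyadic 0 1 0) (rat_code_dyadic 0 0 0)"

lemma decode_gauss_rat_eq: "decode_gauss_rat n = Complex (rat_value (pfst n)) (rat_value (psnd n))"
  by (simp add: decode_gauss_rat_def prod_decode_eq_pair rat_value_def)

lemma decode_gauss_rat_times [simp]:
  "decode_gauss_rat (gauss_code_times x y) = decode_gauss_rat x * decode_gauss_rat y"
  by (simp add: gauss_code_times_def decode_gauss_rat_eq complex_eq_iff)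

lemma decode_gauss_rat_minus_one [simp]: "decode_gauss_rat gauss_code_minus_one = - 1"
  by (simp add: gauss_code_minus_one_def decode_gauss_rat_eq complex_eq_iff)

lemma computable_fun_gauss_code_times [computable_intros]:
  "computable_fun F \<Longrightarrow> computable_fun G \<Longrightarrow> computable_fun (\<lambda>e. gauss_code_times (F e) (G e))"
  unfolding gauss_code_times_def by (intro computable_intros)

section \<open>Arithmetic on codes of rational *-polynomials\<close>

definition code_append :: "nat \<Rightarrow> nat \<Rightarrow> nat" where
  "code_append xs ys = foldl (\<lambda>acc x. Suc (ppair x acc)) ys
     (list_decode (foldl (\<lambda>acc x. Suc (ppair x acc)) 0 (list_decode xs)))"

text \<open>
  The first letter and the list of the others are paired in the code of a monomial, so its
  successor is the code of the list of all letters.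
\<close>

definition monomial_code_times :: "nat \<Rightarrow> nat \<Rightarrow> nat" where
  "monomial_code_times m m' = ppair (gauss_code_times (pfst m) (pfst m'))
     (ppair (pfst (psnd m)) (code_append (psnd (psnd m)) (Suc (psnd m'))))"

text \<open>
  Products and scalar multiples are accumulated onto a further summand; this makes a linear
  combination of products a composition of list folds.
\<close>

definition poly_code_add_scaled :: "nat \<Rightarrow> nat \<Rightarrow> nat \<Rightarrow> nat" where
  "poly_code_add_scaled r g p =
     foldl (\<lambda>acc m. Suc (ppair (ppair (gauss_code_times g (pfst m)) (psnd m)) acc)) r (list_decode p)"

definition poly_code_add_monomial_times :: "nat \<Rightarrow> nat \<Rightarrow> nat \<Rightarrow> nat" where
  "poly_code_add_monomial_times r m p =
     foldl (\<lambda>acc m'. Suc (ppair (monomial_code_times m m') acc)) r (list_decode p)"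

definition poly_code_add_times :: "nat \<Rightarrow> nat \<Rightarrow> nat \<Rightarrow> nat" where
  "poly_code_add_times r p q =
     foldl (\<lambda>acc m. poly_code_add_monomial_times acc m q) r (list_decode p)"

lemma list_decode_code_append [simp]:
  "list_decode (code_append xs ys) = list_decode xs @ list_decode ys"
proof -
  have "list_decode (foldl (\<lambda>acc x. Suc (ppair x acc)) i zs) = rev zs @ list_decode i" for i zs
    by (induction zs arbitrary: i) auto
  then show ?thesis by (simp add: code_append_def)
qed

lemma computable_fun_code_append [computable_intros]:
  "computable_fun F \<Longrightarrow> computable_fun G \<Longrightarrow> computable_fun (\<lambda>e. code_append (F e) (G e))"
  unfolding code_append_def by (intro computable_intros)

lemma computable_fun_monomial_code_times [computable_intros]:
  "computable_fun F \<Longrightarrow> computable_fun G \<Longrightarrow> computable_fun (\<lambda>e. monomial_code_times (F e) (G e))"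
  unfolding monomial_code_times_def by (intro computable_intros)

lemma computable_fun_poly_code_add_scaled [computable_intros]:
  assumes "computable_fun R" "computable_fun G" "computable_fun P"
  shows "computable_fun (\<lambda>e. poly_code_add_scaled (R e) (G e) (P e))"
  unfolding poly_code_add_scaled_def
  by (intro computable_intros assms computable_fun_comp[OF assms(2)])

lemma computable_fun_poly_code_add_monomial_times [computable_intros]:
  assumes "computable_fun R" "computable_fun M" "computable_fun P"
  shows "computable_fun (\<lambda>e. poly_code_add_monomial_times (R e) (M e) (P e))"
  unfolding poly_code_add_monomial_times_def
  by (intro computable_intros assms computable_fun_comp[OF assms(2)])

lemma computable_fun_poly_code_add_times [computable_intros]:
  assumes "computable_fun R" "computable_fun P" "computable_fun Q"
  shows "computable_fun (\<lambda>e. poly_code_add_times (R e) (P e) (Q e))"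
  unfolding poly_code_add_times_def
  by (intro computable_intros assms computable_fun_comp[OF assms(3)])

subsection \<open>Values of polynomial codes\<close>

lemma generated_point_0 [simp]: "generated_point s 0 = 0"
  by (simp add: generated_point_def decode_poly_def eval_poly_def)

lemma generated_point_cons [simp]:
  "generated_point s (Suc (ppair m p)) = eval_monomial s (decode_monomial m) + generated_point s p"
  by (simp add: generated_point_def decode_poly_def eval_poly_def)

lemma generated_point_sum_list:
  "generated_point s p = sum_list (map (\<lambda>m. eval_monomial s (decode_monomial m)) (list_decode p))"
  by (simp add: generated_point_def decode_poly_def eval_poly_def comp_def)

lemma eval_monomial_code:
  "eval_monomial s (decode_monomial m) = decode_gauss_rat (pfst m) *\<^sub>C
     foldl (\<lambda>x l. x * eval_letter s l) (eval_letter s (sum_decode (pfst (psnd m))))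
       (map sum_decode (list_decode (psnd (psnd m))))"
  by (simp add: decode_monomial_def prod_decode_eq_pair)

lemma foldl_mult_eq:
  fixes x :: "'a::cstar_algebra"
  shows "foldl (\<lambda>x l. x * f l) (y * x) ls = y * foldl (\<lambda>x l. x * f l) x ls"
  by (induction ls arbitrary: x) (simp_all add: mult.assoc)

lemma eval_monomial_code_scaled:
  "eval_monomial s (decode_monomial (ppair (gauss_code_times g (pfst m)) (psnd m)))
    = decode_gauss_rat g *\<^sub>C eval_monomial s (decode_monomial m)"
  by (simp add: eval_monomial_code scaleC_scaleC)

lemma eval_monomial_code_times:
  "eval_monomial s (decode_monomial (monomial_code_times m m'))
    = eval_monomial s (decode_monomial m) * eval_monomial s (decode_monomial m')"
proof -
  have "list_decode (Suc (psnd m')) = pfst (psnd m') # list_decode (psnd (psnd m'))"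
    by (rule list_decode_Suc)
  then show ?thesis
    by (simp add: eval_monomial_code monomial_code_times_def foldl_mult_eq scaleC_scaleC
        mult_scaleC_left mult_scaleC_right mult.commute)
qed

lemma generated_point_add_scaled [simp]:
  "generated_point s (poly_code_add_scaled r g p)
    = generated_point s r + decode_gauss_rat g *\<^sub>C generated_point s p"
proof -
  have "generated_point s (foldl (\<lambda>acc m.
      Suc (ppair (ppair (gauss_code_times g (pfst m)) (psnd m)) acc)) r ms)
    = generated_point s r
      + decode_gauss_rat g *\<^sub>C sum_list (map (\<lambda>m. eval_monomial s (decode_monomial m)) ms)" for ms
    by (induction ms arbitrary: r) (simp_all add: eval_monomial_code_scaled scaleC_add_right)
  then show ?thesis by (simp add: poly_code_add_scaled_def generated_point_sum_list[of s p])
qed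

lemma generated_point_add_monomial_times [simp]:
  "generated_point s (poly_code_add_monomial_times r m p)
    = generated_point s r + eval_monomial s (decode_monomial m) * generated_point s p"
proof -
  have "generated_point s (foldl (\<lambda>acc m'. Suc (ppair (monomial_code_times m m') acc)) r ms)
    = generated_point s r + eval_monomial s (decode_monomial m)
      * sum_list (map (\<lambda>m. eval_monomial s (decode_monomial m)) ms)" for ms
    by (induction ms arbitrary: r) (simp_all add: eval_monomial_code_times distrib_left)
  then show ?thesis by (simp add: poly_code_add_monomial_times_def generated_point_sum_list[of s p])
qed

lemma generated_point_add_times [simp]:
  "generated_point s (poly_code_add_times r p q)
    = generated_point s r + generated_point s p * generated_point s q"
proof -
  have "generated_point s (foldl (\<lambda>acc m. poly_code_add_monomial_times acc m q) r ms)
    = generated_point s r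
      + sum_list (map (\<lambda>m. eval_monomial s (decode_monomial m)) ms) * generated_point s q" for ms
    by (induction ms arbitrary: r) (simp_all add: distrib_right)
  then show ?thesis by (simp add: poly_code_add_times_def generated_point_sum_list[of s p])
qed

subsection \<open>Codes of generated points\<close>

text \<open>
  The codes of \<open>x\<^sub>i\<close> and \<open>x\<^sub>i\<^sup>*\<close> are \<open>2 i\<close> and \<open>2 i + 1\<close>, so halving gives the index of the variable.
\<close>

definition monomial_code_ok :: "enat \<Rightarrow> nat \<Rightarrow> bool" where
  "monomial_code_ok N m \<longleftrightarrow> (\<forall>l\<in>set (list_decode (Suc (psnd m))). enat (l div 2) < N)"

lemma is_code_iff: "is_code N c \<longleftrightarrow> (\<forall>m\<in>set (list_decode c). monomial_code_ok N m)"
proof -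
  have "letter_var (sum_decode l) = l div 2" for l by (simp add: sum_decode_def)
  then have "monomial_vars (decode_monomial m) = (\<lambda>l. l div 2) ` set (list_decode (Suc (psnd m)))" for m
    by (simp add: decode_monomial_def prod_decode_eq_pair image_image list_decode_Suc)
  then show ?thesis
    by (auto simp: is_code_def decode_poly_def poly_vars_def monomial_code_ok_def)
qed

lemma is_code_0 [simp]: "is_code N 0"
  by (simp add: is_code_iff)

lemma is_code_cons [simp]: "is_code N (Suc (ppair m p)) \<longleftrightarrow> monomial_code_ok N m \<and> is_code N p"
  by (simp add: is_code_iff)

lemma monomial_code_ok_scaled [simp]: "monomial_code_ok N (ppair c (psnd m)) = monomial_code_ok N m"
  by (simp add: monomial_code_ok_def)

lemma is_code_add_scaled [simp]:
  assumes "is_code N r" "is_code N p"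
  shows "is_code N (poly_code_add_scaled r g p)"
proof -
  have "is_code N (foldl (\<lambda>acc m.
      Suc (ppair (ppair (gauss_code_times g (pfst m)) (psnd m)) acc)) r ms)"
    if "\<forall>m\<in>set ms. monomial_code_ok N m" for ms
    using that assms(1)
    by (induction ms arbitrary: r) auto
  then show ?thesis using assms(2) by (simp add: poly_code_add_scaled_def is_code_iff[of N p])
qed

lemma is_code_add_monomial_times:
  assumes "is_code N r" "monomial_code_ok N m" "is_code N p"
  shows "is_code N (poly_code_add_monomial_times r m p)"
proof -
  have "monomial_code_ok N (monomial_code_times m m')" if "monomial_code_ok N m'" for m'
    using assms(2) that
    by (auto simp: monomial_code_ok_def monomial_code_times_def list_decode_Suc)
  then have "is_code N (foldl (\<lambda>acc m'. Suc (ppair (monomial_code_times m m') acc)) r ms)"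
    if "\<forall>m\<in>set ms. monomial_code_ok N m" for ms
    using that assms(1) by (induction ms arbitrary: r) auto
  then show ?thesis
    using assms(3) by (simp add: poly_code_add_monomial_times_def is_code_iff[of N p])
qed

lemma is_code_add_times [simp]:
  assumes "is_code N r" "is_code N p" "is_code N q"
  shows "is_code N (poly_code_add_times r p q)"
proof -
  have "is_code N (foldl (\<lambda>acc m. poly_code_add_monomial_times acc m q) r ms)"
    if "\<forall>m\<in>set ms. monomial_code_ok N m" for ms
    using that assms(1) by (induction ms arbitrary: r) (auto intro: is_code_add_monomial_times assms(3))
  then show ?thesis using assms(2) by (simp add: poly_code_add_times_def is_code_iff[of N p])
qed

lemma decidable_is_code: "decidable_pred (is_code N)"
proof -
  have "decidable_pred (\<lambda>t. enat (pfst t div 2) < N)"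
  proof (cases N)
    case (enat n)
    then show ?thesis by (simp only: enat_ord_simps) (intro computable_intros)
  next
    case infinity
    then show ?thesis by (simp add: decidable_pred_def computable_fun_const)
  qed
  then have "decidable_pred (\<lambda>e. \<forall>l\<in>set (list_decode (Suc (psnd e))). enat (l div 2) < N)"
    by (rule decidable_list_all) (intro computable_intros)
  from decidable_pred_comp[OF this, of pfst]
  have "decidable_pred (\<lambda>t. monomial_code_ok N (pfst t))"
    by (simp add: monomial_code_ok_def computable_fun_pfst[OF computable_fun_id])
  from decidable_list_all[OF this computable_fun_id] show ?thesis
    by (simp add: is_code_iff[abs_def])
qed

section \<open>Computable families of real numbers\<close>

definition computable_real :: "(nat \<Rightarrow> real) \<Rightarrow> bool" where
  "computable_real X \<longleftrightarrow> (\<exists>q. computable_fun q \<and>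
     (\<forall>e j. \<bar>X e - rat_value (q (ppair e j))\<bar> < (1 / 2) ^ j))"

named_theorems computable_real_intros

lemma computable_real_norm:
  assumes "computable_presentation N s" "computable_fun F" "\<And>e. is_code N (F e)"
  shows "computable_real (\<lambda>e. norm (generated_point s (F e)))"
proof -
  obtain f where f: "recursive 2 f"
    "\<And>c k. is_code N c \<Longrightarrow> \<bar>norm (generated_point s c) - rat_value (f [c, k])\<bar> < (1 / 2) ^ k"
    using assms(1) by (auto simp: computable_presentation_def rat_value_def)
  show ?thesis
    unfolding computable_real_def
  proof (intro exI conjI allI)
    show "computable_fun (\<lambda>t. f [F (pfst t), psnd t])"
      by (intro computable_fun_recursive2[OF f(1)] computable_fun_comp[OF assms(2)] computable_intros)
    show "\<bar>norm (generated_point s (F e)) - rat_value (f [F (pfst (ppair e j)), psnd (ppair e j)])\<bar>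
        < (1 / 2) ^ j" for e j
      using f(2)[OF assms(3)] by simp
  qed
qed

lemma computable_real_add [computable_real_intros]:
  assumes "computable_real X" "computable_real Y"
  shows "computable_real (\<lambda>e. X e + Y e)"
proof -
  obtain p q where p: "computable_fun p" "\<And>e j. \<bar>X e - rat_value (p (ppair e j))\<bar> < (1 / 2) ^ j"
    and q: "computable_fun q" "\<And>e j. \<bar>Y e - rat_value (q (ppair e j))\<bar> < (1 / 2) ^ j"
    using assms by (auto simp: computable_real_def)
  show ?thesis
    unfolding computable_real_def
  proof (intro exI conjI allI)
    show "computable_fun (\<lambda>t. rat_code_plus (p (ppair (pfst t) (Suc (psnd t))))
        (q (ppair (pfst t) (Suc (psnd t)))))"
      by (intro computable_intros computable_fun_comp[OF p(1)] computable_fun_comp[OF q(1)])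
    show "\<bar>X e + Y e - rat_value (rat_code_plus
        (p (ppair (pfst (ppair e j)) (Suc (psnd (ppair e j)))))
        (q (ppair (pfst (ppair e j)) (Suc (psnd (ppair e j))))))\<bar> < (1 / 2) ^ j" for e j
      using p(2)[of e "Suc j"] q(2)[of e "Suc j"]
      by (simp only: pfst_ppair psnd_ppair rat_value_plus power_Suc)
  qed
qed

lemma computable_real_scale [computable_real_intros]:
  assumes "computable_fun F" "computable_real X"
  shows "computable_real (\<lambda>e. (1 / 2) ^ F e * X e)"
proof -
  obtain q where q: "computable_fun q" "\<And>e j. \<bar>X e - rat_value (q (ppair e j))\<bar> < (1 / 2) ^ j"
    using assms by (auto simp: computable_real_def)
  show ?thesis
    unfolding computable_real_def
  proof (intro exI conjI allI)
    show "computable_fun (\<lambda>t. rat_code_times (rat_code_dyadic 1 0 (F (pfst t))) (q t))"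
      by (intro computable_intros computable_fun_comp[OF assms(1)] q(1))
    show "\<bar>(1 / 2) ^ F e * X e
        - rat_value (rat_code_times (rat_code_dyadic 1 0 (F (pfst (ppair e j)))) (q (ppair e j)))\<bar>
        < (1 / 2) ^ j" for e j
    proof -
      have "\<bar>(1 / 2) ^ F e * X e
          - rat_value (rat_code_times (rat_code_dyadic 1 0 (F (pfst (ppair e j)))) (q (ppair e j)))\<bar>
          = (1 / 2) ^ F e * \<bar>X e - rat_value (q (ppair e j))\<bar>"
        by (simp add: power_divide diff_divide_distrib[symmetric] abs_mult)
      also have "\<dots> \<le> 1 * \<bar>X e - rat_value (q (ppair e j))\<bar>"
        by (intro mult_right_mono power_le_one) auto
      also have "\<dots> < (1 / 2) ^ j" using q(2) by simp
      finally show ?thesis .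
    qed
  qed
qed

lemma computable_real_uminus:
  assumes "computable_real X"
  shows "computable_real (\<lambda>e. - X e)"
proof -
  obtain q where q: "computable_fun q" "\<And>e j. \<bar>X e - rat_value (q (ppair e j))\<bar> < (1 / 2) ^ j"
    using assms by (auto simp: computable_real_def)
  show ?thesis
    unfolding computable_real_def
  proof (intro exI conjI allI)
    show "computable_fun (\<lambda>t. rat_code_times (rat_code_dyadic 0 1 0) (q t))"
      by (intro computable_intros q(1))
    show "\<bar>- X e - rat_value (rat_code_times (rat_code_dyadic 0 1 0) (q (ppair e j)))\<bar> < (1 / 2) ^ j"
      for e j using q(2)[of e j] by simp
  qed
qed

lemma computable_real_diff [computable_real_intros]:
  "computable_real X \<Longrightarrow> computable_real Y \<Longrightarrow> computable_real (\<lambda>e. X e - Y e)"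
  using computable_real_add[of X "\<lambda>e. - Y e"] computable_real_uminus[of Y] by simp

lemma computable_real_half_power [computable_real_intros]:
  assumes "computable_fun F"
  shows "computable_real (\<lambda>e. (1 / 2) ^ F e)"
  unfolding computable_real_def
proof (intro exI conjI allI)
  show "computable_fun (\<lambda>t. rat_code_dyadic 1 0 (F (pfst t)))"
    by (intro computable_intros computable_fun_comp[OF assms(1)])
  show "\<bar>(1 / 2) ^ F e - rat_value (rat_code_dyadic 1 0 (F (pfst (ppair e j))))\<bar> < (1 / 2) ^ j" for e j
    by (simp add: power_divide)
qed

lemma computable_real_If [computable_real_intros]:
  assumes "decidable_pred P" "computable_real X" "computable_real Y"
  shows "computable_real (\<lambda>e. if P e then X e else Y e)"
proof -
  obtain p q where p: "computable_fun p" "\<And>e j. \<bar>X e - rat_value (p (ppair e j))\<bar> < (1 / 2) ^ j"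
    and q: "computable_fun q" "\<And>e j. \<bar>Y e - rat_value (q (ppair e j))\<bar> < (1 / 2) ^ j"
    using assms by (auto simp: computable_real_def)
  show ?thesis
    unfolding computable_real_def
  proof (intro exI conjI allI)
    show "computable_fun (\<lambda>t. if P (pfst t) then p t else q t)"
      by (intro computable_intros decidable_pred_comp[OF assms(1)] p(1) q(1))
    show "\<bar>(if P e then X e else Y e)
        - rat_value (if P (pfst (ppair e j)) then p (ppair e j) else q (ppair e j))\<bar> < (1 / 2) ^ j" for e j
      using p(2) q(2) by simp
  qed
qed

text \<open>
  Positivity of a computable real is semidecidable, so an unbounded search over candidates and
  precisions finds a witness wherever there is one.
\<close>

theorem computable_selection:
  fixes X :: "nat \<Rightarrow> nat \<Rightarrow> real"
  assumes "computable_real (\<lambda>t. X (pfst t) (psnd t))" and ex: "\<And>e. \<exists>c. 0 < X e c"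
  obtains h where "computable_fun h" "\<And>e. 0 < X e (h e)"
proof -
  obtain q where q: "computable_fun q"
    "\<And>t j. \<bar>X (pfst t) (psnd t) - rat_value (q (ppair t j))\<bar> < (1 / 2) ^ j"
    using assms(1) by (auto simp: computable_real_def)
  define P where "P t e \<longleftrightarrow> 0 < rat_value (rat_code_plus
    (q (ppair (ppair e (pfst t)) (psnd t))) (rat_code_dyadic 0 1 (psnd t)))" for t e
  have sound: "0 < X e (pfst t)" if "P t e" for t e
    using that q(2)[of "ppair e (pfst t)" "psnd t"] by (simp add: P_def power_divide)
  have complete: "\<exists>t. P t e" for e
  proof -
    obtain c where c: "0 < X e c" using ex by blast
    then obtain j where j: "(1 / 2) ^ j < X e c / 2"
      using real_arch_pow_inv[of "X e c / 2" "1 / 2"] by auto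
    then have "P (ppair c j) e"
      using q(2)[of "ppair e c" j] by (simp add: P_def power_divide abs_less_iff)
    then show ?thesis by blast
  qed
  have "computable_fun (\<lambda>e. pfst (LEAST t. P t e))"
  proof (intro computable_fun_pfst computable_fun_Least complete)
    show "decidable_pred (\<lambda>t. P (pfst t) (psnd t))"
      unfolding P_def by (intro computable_intros computable_fun_comp[OF q(1)])
  qed
  moreover have "0 < X e (pfst (LEAST t. P t e))" for e
    by (rule sound, rule LeastI_ex[OF complete])
  ultimately show ?thesis by (rule that)
qed

section \<open>Density of the generated points\<close>

lemma bounded_bilinear_scaleC: "bounded_bilinear ((*\<^sub>C) :: complex \<Rightarrow> 'a \<Rightarrow> 'a::cstar_algebra)"
proof
  show "(r *\<^sub>R c) *\<^sub>C x = r *\<^sub>R (c *\<^sub>C x)" for r c and x :: 'a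
    by (simp add: scaleC_scaleC scaleR_conv_of_real flip: scaleC_of_real)
  show "\<exists>K. \<forall>c (x::'a). norm (c *\<^sub>C x) \<le> norm c * norm x * K"
    by (rule exI[of _ 1]) (simp add: norm_scaleC)
qed (simp_all add: scaleC_add_left scaleC_add_right scaleC_scaleR)

lemma tendsto_star: "(f \<longlongrightarrow> x) F \<Longrightarrow> ((\<lambda>n. star (f n)) \<longlongrightarrow> star (x::'a::cstar_algebra)) F"
  by (simp add: tendsto_iff dist_norm flip: star_diff)

lemma decode_gauss_rat_dense: "closure (range decode_gauss_rat) = UNIV"
proof -
  have "\<exists>n. dist (decode_gauss_rat n) z < \<epsilon>" if "0 < \<epsilon>" for z \<epsilon>
  proof -
    obtain x y where xy: "x \<in> \<rat>" "Re z < x" "x < Re z + \<epsilon> / 2" "y \<in> \<rat>" "Im z < y" "y < Im z + \<epsilon> / 2"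
      using Rats_dense_in_real[of "Re z" "Re z + \<epsilon> / 2"] Rats_dense_in_real[of "Im z" "Im z + \<epsilon> / 2"]
        \<open>0 < \<epsilon>\<close> by auto
    obtain m n where "x = rat_value m" "y = rat_value n"
      using surj_of_rat_nat_to_rat_surj xy(1,4) unfolding rat_value_def by metis
    then have "decode_gauss_rat (ppair m n) = Complex x y" by (simp add: decode_gauss_rat_eq)
    moreover have "cmod (Complex x y - z) < \<epsilon>"
      using cmod_le[of "Complex x y - z"] xy by simp
    ultimately show ?thesis by (intro exI[of _ "ppair m n"]) (simp add: dist_norm)
  qed
  then show ?thesis by (auto simp: closure_approachable)
qed

text \<open>
  The generated points are closed under the operations of a *-algebra over the Gaussian rationals,
  which are dense in the plane; hence their closure is a *-subalgebra over the complex numbers.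
\<close>

lemma generated_points_dense:
  fixes s :: "nat \<Rightarrow> 'a::cstar_algebra"
  assumes "presentation N s"
  shows "closure {generated_point s c | c. is_code N c} = UNIV"
proof -
  define G where "G = {generated_point s c | c. is_code N c}"
  define one where "one = ppair (rat_code_dyadic 1 0 0) (rat_code_dyadic 0 0 0)"
  have one: "decode_gauss_rat one = 1"
    by (simp add: one_def decode_gauss_rat_eq complex_eq_iff)
  have G_0: "0 \<in> G" unfolding G_def using generated_point_0 is_code_0 by (metis (mono_tags, lifting) mem_Collect_eq)
  have G_add: "x + y \<in> G" if xy: "x \<in> G" "y \<in> G" for x y
  proof -
    obtain p q where "x = generated_point s p" "is_code N p" "y = generated_point s q" "is_code N q"
      using xy by (auto simp: G_def)
    then show ?thesis
      unfolding G_def by (intro CollectI exI[of _ "poly_code_add_scaled p one q"]) (simp add: one)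
  qed
  have G_mult: "x * y \<in> G" if xy: "x \<in> G" "y \<in> G" for x y
  proof -
    obtain p q where "x = generated_point s p" "is_code N p" "y = generated_point s q" "is_code N q"
      using xy by (auto simp: G_def)
    then show ?thesis
      unfolding G_def by (intro CollectI exI[of _ "poly_code_add_times 0 p q"]) simp
  qed
  have G_scale: "decode_gauss_rat g *\<^sub>C x \<in> G" if x: "x \<in> G" for x g
  proof -
    obtain p where "x = generated_point s p" "is_code N p"
      using x by (auto simp: G_def)
    then show ?thesis
      unfolding G_def by (intro CollectI exI[of _ "poly_code_add_scaled 0 g p"]) simp
  qed
  have G_letter: "eval_letter s l \<in> G" if "enat (letter_var l) < N" for l
  proof -
    have "letter_var (sum_decode n) = n div 2" for n by (simp add: sum_decode_def)
    from this[of "sum_encode l"] have "is_code N (Suc (ppair (ppair one (ppair (sum_encode l) 0)) 0))"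
      using that by (simp add: monomial_code_ok_def)
    then show ?thesis
      unfolding G_def
      by (intro CollectI exI[of _ "Suc (ppair (ppair one (ppair (sum_encode l) 0)) 0)"])
        (simp add: eval_monomial_code one)
  qed
  have G_star_letter: "star (eval_letter s l) \<in> G" if "enat (letter_var l) < N" for l
    using that G_letter[of "Inl (letter_var l)"] G_letter[of "Inr (letter_var l)"]
    by (cases l) (auto simp: star_star)
  have G_star_word: "star (foldl (\<lambda>x l. x * eval_letter s l) x ls) \<in> G"
    if "star x \<in> G" "\<forall>l\<in>set ls. enat (letter_var l) < N" for x ls
    using that by (induction ls arbitrary: x) (auto simp: star_mult G_mult G_star_letter)
  have G_star_poly: "star (sum_list (map (eval_monomial s) ms)) \<in> G"
    if "\<forall>m\<in>set ms. \<exists>g l ls. m = (decode_gauss_rat g, l, ls) \<and> (\<forall>l\<in>set (l # ls). enat (letter_var l) < N)"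
    for ms
    using that
  proof (induction ms)
    case (Cons m ms)
    then obtain g l ls where m: "m = (decode_gauss_rat g, l, ls)"
      "\<forall>l\<in>set (l # ls). enat (letter_var l) < N" by auto
    define w where "w = foldl (\<lambda>x l. x * eval_letter s l) (eval_letter s l) ls"
    obtain g' where g': "decode_gauss_rat g' = cnj (decode_gauss_rat g)"
    proof
      show "decode_gauss_rat (ppair (pfst g) (rat_code_times (rat_code_dyadic 0 1 0) (psnd g)))
          = cnj (decode_gauss_rat g)"
        by (simp add: decode_gauss_rat_eq complex_eq_iff)
    qed
    have "star w \<in> G" unfolding w_def using m(2) by (intro G_star_word G_star_letter) auto
    then have "star (decode_gauss_rat g *\<^sub>C w) \<in> G"
      using G_scale[of "star w" g'] by (simp add: star_scaleC g')
    then show ?case using Cons by (simp add: m(1) star_add G_add flip: w_def)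
  qed (simp add: G_0)
  have G_star: "star x \<in> G" if x: "x \<in> G" for x
  proof -
    obtain c where c: "x = generated_point s c" "is_code N c" using x by (auto simp: G_def)
    have "\<forall>m\<in>set (decode_poly c). \<exists>g l ls. m = (decode_gauss_rat g, l, ls)
        \<and> (\<forall>l\<in>set (l # ls). enat (letter_var l) < N)"
    proof
      fix m assume "m \<in> set (decode_poly c)"
      then obtain n where n: "m = decode_monomial n" by (auto simp: decode_poly_def)
      have "\<forall>l\<in>monomial_vars m. enat l < N"
        using c(2) \<open>m \<in> set (decode_poly c)\<close> by (auto simp: is_code_def poly_vars_def)
      then show "\<exists>g l ls. m = (decode_gauss_rat g, l, ls)
          \<and> (\<forall>l\<in>set (l # ls). enat (letter_var l) < N)"
        unfolding n decode_monomial_def prod_decode_eq_pair by fastforce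
    qed
    from G_star_poly[OF this] show ?thesis
      by (simp add: c(1) generated_point_def eval_poly_def)
  qed
  have lim: "y \<in> closure G" if "\<And>n. u n \<in> G" "u \<longlonglongrightarrow> y" for u y
    unfolding closure_sequential using that by blast
  have "star_subalgebra (closure G)"
    unfolding star_subalgebra_def
  proof (intro conjI ballI allI)
    show "0 \<in> closure G" using G_0 closure_subset by blast
    fix x assume "x \<in> closure G"
    then obtain f where f: "\<And>n. f n \<in> G" "f \<longlonglongrightarrow> x" by (auto simp: closure_sequential)
    show "star x \<in> closure G"
      by (rule lim[OF G_star[OF f(1)] tendsto_star[OF f(2)]])
    show "c *\<^sub>C x \<in> closure G" for c
    proof -
      have "c \<in> closure (range decode_gauss_rat)" by (simp add: decode_gauss_rat_dense)
      then obtain g where g: "\<And>n. g n \<in> range decode_gauss_rat" "g \<longlonglongrightarrow> c"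
        by (auto simp: closure_sequential)
      have "(\<lambda>n. g n *\<^sub>C f n) \<longlonglongrightarrow> c *\<^sub>C x"
        by (rule bounded_bilinear.tendsto[OF bounded_bilinear_scaleC g(2) f(2)])
      moreover have "g n *\<^sub>C f n \<in> G" for n using g(1)[of n] f(1)[of n] G_scale by auto
      ultimately show ?thesis by (rule lim[rotated])
    qed
    fix y assume "y \<in> closure G"
    then obtain h where h: "\<And>n. h n \<in> G" "h \<longlonglongrightarrow> y" by (auto simp: closure_sequential)
    show "x + y \<in> closure G"
      by (rule lim[OF G_add[OF f(1) h(1)] tendsto_add[OF f(2) h(2)]])
    show "x * y \<in> closure G"
      by (rule lim[OF G_mult[OF f(1) h(1)] tendsto_mult[OF f(2) h(2)]])
  qed
  moreover have "{s i | i. enat i < N} \<subseteq> closure G"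
    using G_letter[of "Inl i" for i] closure_subset[of G] by auto
  ultimately have "star_subalgebra hull {s i | i. enat i < N} \<subseteq> closure G"
    by (intro hull_minimal)
  then have "closure (star_subalgebra hull {s i | i. enat i < N}) \<subseteq> closure G"
    by (simp add: closure_minimal)
  then show ?thesis using assms by (auto simp: presentation_def G_def)
qed

lemma positive_at_generated_point:
  assumes "presentation N s" "continuous_on UNIV (\<phi> :: 'a::cstar_algebra \<Rightarrow> real)" "0 < \<phi> x"
  obtains c where "is_code N c" "0 < \<phi> (generated_point s c)"
proof -
  have "open {y. 0 < \<phi> y}"
    using assms(2) by (intro open_Collect_less) auto
  moreover have "x \<in> closure {generated_point s c | c. is_code N c}"
    by (simp add: generated_points_dense[OF assms(1)])
  ultimately show ?thesis
    using that assms(3) open_Int_closure_eq_empty[of "{y. 0 < \<phi> y}" "{generated_point s c | c. is_code N c}"]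
    by blast
qed

section \<open>The search at one grid point\<close>

text \<open>
  The two kinds of witness for the point \<open>g\<close>: the first excess is positive if \<open>b\<close> shows, with the
  approximation \<open>p\<close> of \<open>a\<close> up to \<open>2\<^sup>-\<^sup>j\<close>, that the ball of radius \<open>2\<^sup>-\<^sup>k\<close> around \<open>g\<close> meets the
  spectrum; the second if \<open>b\<close> shows that a point of the spectrum within \<open>2\<^sup>-\<^sup>h\<close> of \<open>g\<close> has modulus
  less than \<open>2\<^sup>-\<^sup>n\<close>.
\<close>

definition meeting_excess :: "nat \<Rightarrow> 'a::cstar_algebra \<Rightarrow> complex \<Rightarrow> nat \<Rightarrow> 'a \<Rightarrow> real" where
  "meeting_excess k p g j b =
     (1 / 2) ^ k * norm b - norm (shifted_mult p g b) - (1 / 2) ^ j * norm b"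

definition avoiding_excess :: "nat \<Rightarrow> nat \<Rightarrow> 'a::cstar_algebra \<Rightarrow> complex \<Rightarrow> nat \<Rightarrow> 'a \<Rightarrow> real" where
  "avoiding_excess n h p g j b =
     (1 / 2) ^ n - norm (shifted_mult p g b - p) - (1 / 2) ^ h * norm b
       - (1 / 2) ^ j * norm b - (1 / 2) ^ j"

lemma norm_shifted_mult_approx:
  "norm (shifted_mult a g b) \<le> norm (shifted_mult p g b) + norm (a - p) * norm b"
proof -
  have "shifted_mult a g b = shifted_mult p g b + (a - p) * b"
    by (simp add: shifted_mult_def left_diff_distrib)
  then show ?thesis
    using norm_triangle_ineq[of "shifted_mult p g b" "(a - p) * b"] norm_mult_ineq[of "a - p" b]
    by simp
qed

lemma norm_shifted_mult_minus_approx: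
  "norm (shifted_mult a g b - a) \<le> norm (shifted_mult p g b - p) + norm (a - p) * norm b + norm (a - p)"
proof -
  have "shifted_mult a g b - a = (shifted_mult p g b - p) + (a - p) * b - (a - p)"
    by (simp add: shifted_mult_def left_diff_distrib)
  then have "norm (shifted_mult a g b - a)
      \<le> norm (shifted_mult p g b - p) + norm ((a - p) * b) + norm (a - p)"
    by (metis norm_triangle_ineq4 norm_triangle_ineq add_right_mono order_trans)
  then show ?thesis using norm_mult_ineq[of "a - p" b] by simp
qed

lemma meeting_excess_sound:
  assumes a: "normal_elem a" and p: "norm (a - p) \<le> (1 / 2) ^ j" and pos: "0 < meeting_excess k p g j b"
  shows "\<exists>m\<in>cstar_spectrum a. cmod (m - g) < (1 / 2) ^ k"
proof (rule spectrum_meets_ball[OF a])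
  show "norm (shifted_mult a g b) < (1 / 2) ^ k * norm b"
    using norm_shifted_mult_approx[of a g b p] mult_right_mono[OF p norm_ge_zero[of b]] pos
    by (simp add: meeting_excess_def)
qed

lemma avoiding_excess_sound:
  assumes a: "normal_elem a" and p: "norm (a - p) \<le> (1 / 2) ^ j"
    and pos: "0 < avoiding_excess n h p g j b"
    and m: "m \<in> cstar_spectrum a" "cmod (m - g) \<le> (1 / 2) ^ h"
  shows "cmod m < (1 / 2) ^ n"
  using spectrum_excluded[OF a m(1), of g b] mult_right_mono[OF m(2) norm_ge_zero[of b]]
    norm_shifted_mult_minus_approx[of a g b p] mult_right_mono[OF p norm_ge_zero[of b]] p pos
  by (simp add: avoiding_excess_def)

lemma continuous_on_shifted_mult: "continuous_on A (shifted_mult a g)"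
proof -
  have "shifted_mult a g = (\<lambda>x. a * x - g *\<^sub>C x)" by (simp add: fun_eq_iff shifted_mult_def)
  then show ?thesis
    by (auto intro!: continuous_intros bounded_bilinear.continuous_on[OF bounded_bilinear_scaleC])
qed

lemma half_power_less:
  assumes "0 < (\<epsilon>::real)"
  obtains j where "(1 / 2) ^ j * C < \<epsilon>"
proof -
  obtain j where j: "(1 / 2) ^ j < \<epsilon> / (\<bar>C\<bar> + 1)"
    using real_arch_pow_inv[of "\<epsilon> / (\<bar>C\<bar> + 1)" "1 / 2"] assms by auto
  have "(1 / 2) ^ j * C \<le> (1 / 2) ^ j * (\<bar>C\<bar> + 1)" by (intro mult_left_mono) auto
  also have "\<dots> < \<epsilon>" using j by (simp add: field_simps)
  finally show ?thesis by (rule that)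
qed

text \<open>
  If no \<open>x\<close> shows that the ball of radius \<open>2\<^sup>-\<^sup>k\<close> meets the spectrum, then \<open>a - g\<close> is bounded below
  by \<open>2\<^sup>-\<^sup>k\<close>, so \<open>(a - g) b = a\<close> has a solution with \<open>\<parallel>b\<parallel> \<le> 2\<^sup>k \<parallel>a\<parallel> < 2\<^sup>k\<^sup>+\<^sup>r\<close>; the exponent
  \<open>n + k + r\<close> makes the avoidance excess positive at it. In both cases the excess stays positive at a
  nearby generated point and a good enough approximation of \<open>a\<close>.
\<close>

lemma search_succeeds:
  assumes "presentation N s" and a: "normal_elem a" and norm_a: "norm a < 2 ^ r"
    and p: "\<And>j. norm (a - p j) \<le> (1 / 2) ^ j"
  shows "\<exists>c j. is_code N c \<and> (0 < meeting_excess k (p j) g j (generated_point s c)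
    \<or> 0 < avoiding_excess n (n + k + r) (p j) g j (generated_point s c))"
proof (cases "\<exists>x. norm (shifted_mult a g x) < (1 / 2) ^ k * norm x")
  case True
  then obtain x where x: "norm (shifted_mult a g x) < (1 / 2) ^ k * norm x" ..
  let ?\<phi> = "\<lambda>y. (1 / 2) ^ k * norm y - norm (shifted_mult a g y)"
  obtain c where c: "is_code N c" "0 < ?\<phi> (generated_point s c)"
  proof (rule positive_at_generated_point[OF assms(1)])
    show "continuous_on UNIV ?\<phi>" by (intro continuous_intros continuous_on_shifted_mult)
    show "0 < ?\<phi> x" using x by simp
  qed
  define b where "b = generated_point s c"
  obtain j where j: "(1 / 2) ^ j * (2 * norm b) < ?\<phi> b"
    using half_power_less c(2) unfolding b_def by blast
  have "norm (p j - a) * norm b \<le> (1 / 2) ^ j * norm b"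
    using p[of j] by (intro mult_right_mono) (simp_all add: norm_minus_commute)
  then have "0 < meeting_excess k (p j) g j b"
    using norm_shifted_mult_approx[of "p j" g b a] j by (simp add: meeting_excess_def)
  then show ?thesis using c(1) b_def by blast
next
  case False
  then have low: "(1 / 2) ^ k * norm x \<le> norm (shifted_mult a g x)" for x
    by (simp add: not_less)
  have "surj (shifted_mult a g)" by (rule surj_shifted_mult[OF a _ low]) simp
  then obtain x where x: "a = shifted_mult a g x" by (rule surjE)
  define h where "h = n + k + r"
  have "norm x \<le> 2 ^ k * norm a"
    using low[of x] by (simp add: power_divide field_simps flip: x)
  also have "\<dots> < 2 ^ k * 2 ^ r" using norm_a by simp
  finally have norm_x: "(1 / 2) ^ h * norm x < (1 / 2) ^ n"
    by (simp add: h_def power_divide power_add field_simps)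
  let ?\<psi> = "\<lambda>y. (1 / 2) ^ n - norm (shifted_mult a g y - a) - (1 / 2) ^ h * norm y"
  obtain c where c: "is_code N c" "0 < ?\<psi> (generated_point s c)"
  proof (rule positive_at_generated_point[OF assms(1)])
    show "continuous_on UNIV ?\<psi>" by (intro continuous_intros continuous_on_shifted_mult)
    show "0 < ?\<psi> x" using norm_x by (simp flip: x)
  qed
  define b where "b = generated_point s c"
  obtain j where j: "(1 / 2) ^ j * (2 * norm b + 2) < ?\<psi> b"
    using half_power_less c(2) unfolding b_def by blast
  have "norm (p j - a) * norm b \<le> (1 / 2) ^ j * norm b" "norm (p j - a) \<le> (1 / 2) ^ j"
    using p[of j] by (auto intro!: mult_right_mono simp: norm_minus_commute)
  then have "0 < avoiding_excess n h (p j) g j b"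
    using norm_shifted_mult_minus_approx[of "p j" g b a] j
    by (simp add: avoiding_excess_def distrib_left)
  then show ?thesis using c(1) b_def h_def by blast
qed

section \<open>Computability of the search\<close>

text \<open>
  Replacing a number that is not a code by \<open>0\<close>, a code of the zero polynomial, makes every number a
  candidate.
\<close>

definition code_or_zero :: "enat \<Rightarrow> nat \<Rightarrow> nat" where
  "code_or_zero N c = (if is_code N c then c else 0)"

lemma is_code_code_or_zero [simp]: "is_code N (code_or_zero N c)"
  by (simp add: code_or_zero_def)

lemma code_or_zero_eq [simp]: "is_code N c \<Longrightarrow> code_or_zero N c = c"
  by (simp add: code_or_zero_def)

lemma computable_fun_code_or_zero [computable_intros]:
  "computable_fun F \<Longrightarrow> computable_fun (\<lambda>e. code_or_zero N (F e))"
  unfolding code_or_zero_def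
  by (intro computable_intros decidable_pred_comp[OF decidable_is_code])

definition shifted_mult_code :: "nat \<Rightarrow> nat \<Rightarrow> nat \<Rightarrow> nat" where
  "shifted_mult_code p g b =
     poly_code_add_scaled (poly_code_add_times 0 p b) (gauss_code_times gauss_code_minus_one g) b"

definition shifted_mult_minus_code :: "nat \<Rightarrow> nat \<Rightarrow> nat \<Rightarrow> nat" where
  "shifted_mult_minus_code p g b =
     poly_code_add_scaled (shifted_mult_code p g b) gauss_code_minus_one p"

lemma generated_point_shifted_mult_code [simp]:
  "generated_point s (shifted_mult_code p g b)
    = shifted_mult (generated_point s p) (decode_gauss_rat g) (generated_point s b)"
  by (simp add: shifted_mult_code_def shifted_mult_def)

lemma generated_point_shifted_mult_minus_code [simp]:
  "generated_point s (shifted_mult_minus_code p g b)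
    = shifted_mult (generated_point s p) (decode_gauss_rat g) (generated_point s b)
      - generated_point s p"
  by (simp add: shifted_mult_minus_code_def)

lemma is_code_shifted_mult_code [simp]:
  "is_code N p \<Longrightarrow> is_code N b \<Longrightarrow> is_code N (shifted_mult_code p g b)"
  "is_code N p \<Longrightarrow> is_code N b \<Longrightarrow> is_code N (shifted_mult_minus_code p g b)"
  by (simp_all add: shifted_mult_code_def shifted_mult_minus_code_def)

lemma computable_fun_shifted_mult_code [computable_intros]:
  "computable_fun P \<Longrightarrow> computable_fun G \<Longrightarrow> computable_fun B \<Longrightarrow>
    computable_fun (\<lambda>e. shifted_mult_code (P e) (G e) (B e))"
  unfolding shifted_mult_code_def by (intro computable_intros)

lemma computable_fun_shifted_mult_minus_code [computable_intros]:
  "computable_fun P \<Longrightarrow> computable_fun G \<Longrightarrow> computable_fun B \<Longrightarrow>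
    computable_fun (\<lambda>e. shifted_mult_minus_code (P e) (G e) (B e))"
  unfolding shifted_mult_minus_code_def by (intro computable_intros)

lemma computable_real_meeting_excess:
  assumes "computable_presentation N s"
    and "computable_fun K" "computable_fun P" "computable_fun G" "computable_fun J" "computable_fun B"
    and "\<And>e. is_code N (P e)" "\<And>e. is_code N (B e)"
  shows "computable_real (\<lambda>e. meeting_excess (K e) (generated_point s (P e))
    (decode_gauss_rat (G e)) (J e) (generated_point s (B e)))"
proof -
  have "computable_real (\<lambda>e. norm (generated_point s (shifted_mult_code (P e) (G e) (B e))))"
    by (rule computable_real_norm[OF assms(1)]) (intro computable_intros assms | simp add: assms)+
  then have "computable_real (\<lambda>e. norm (shifted_mult (generated_point s (P e))
      (decode_gauss_rat (G e)) (generated_point s (B e))))" by simp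
  then show ?thesis
    unfolding meeting_excess_def
    by (intro computable_real_intros computable_real_norm[OF assms(1)] assms)
qed

lemma computable_real_avoiding_excess:
  assumes "computable_presentation N s"
    and "computable_fun M" "computable_fun H" "computable_fun P" "computable_fun G"
      "computable_fun J" "computable_fun B"
    and "\<And>e. is_code N (P e)" "\<And>e. is_code N (B e)"
  shows "computable_real (\<lambda>e. avoiding_excess (M e) (H e) (generated_point s (P e))
    (decode_gauss_rat (G e)) (J e) (generated_point s (B e)))"
proof -
  have "computable_real (\<lambda>e. norm (generated_point s (shifted_mult_minus_code (P e) (G e) (B e))))"
    by (rule computable_real_norm[OF assms(1)]) (intro computable_intros assms | simp add: assms)+
  then have "computable_real (\<lambda>e. norm (shifted_mult (generated_point s (P e))
      (decode_gauss_rat (G e)) (generated_point s (B e)) - generated_point s (P e)))" by simp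
  then show ?thesis
    unfolding avoiding_excess_def
    by (intro computable_real_intros computable_real_norm[OF assms(1)] assms)
qed

section \<open>The grid\<close>

text \<open>The mesh is \<open>2\<^sup>-\<^sup>h\<^sup>-\<^sup>1\<close>, and the grid covers the square of half side \<open>2\<^sup>r\<close>.\<close>

definition grid_offset :: "nat \<Rightarrow> nat \<Rightarrow> nat" where
  "grid_offset r h = Suc (2 ^ (r + Suc h))"

definition grid_code :: "nat \<Rightarrow> nat \<Rightarrow> nat \<Rightarrow> nat" where
  "grid_code r h x = ppair (rat_code_dyadic (pfst x) (grid_offset r h) (Suc h))
     (rat_code_dyadic (psnd x) (grid_offset r h) (Suc h))"

definition grid_size :: "nat \<Rightarrow> nat \<Rightarrow> nat" where
  "grid_size r h = Suc (ppair (2 * grid_offset r h) (2 * grid_offset r h))"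

lemma dyadic_approx:
  assumes "\<bar>t\<bar> < 2 ^ r"
  obtains x where "x \<le> 2 * grid_offset r h"
    "\<bar>t - (real x - real (grid_offset r h)) / 2 ^ Suc h\<bar> \<le> (1 / 2) ^ Suc h"
proof
  define M where "M = grid_offset r h"
  define z where "z = \<lfloor>t * 2 ^ Suc h\<rfloor> + int M"
  have "\<bar>t * 2 ^ Suc h\<bar> < 2 ^ r * 2 ^ Suc h" using assms by (simp add: abs_mult)
  also have "\<dots> = real M - 1" by (simp add: M_def grid_offset_def power_add)
  finally have t: "\<bar>t * 2 ^ Suc h\<bar> < real M - 1" .
  have z: "0 \<le> z" "z \<le> 2 * int M" unfolding z_def using t by linarith+
  then show "nat z \<le> 2 * grid_offset r h" by (simp add: M_def)
  have "real (nat z) - real M = \<lfloor>t * 2 ^ Suc h\<rfloor>" using z by (simp add: z_def)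
  moreover have "\<bar>t - \<lfloor>t * 2 ^ Suc h\<rfloor> / 2 ^ Suc h\<bar> \<le> (1 / 2) ^ Suc h"
  proof -
    have "t - \<lfloor>t * 2 ^ Suc h\<rfloor> / 2 ^ Suc h = (t * 2 ^ Suc h - \<lfloor>t * 2 ^ Suc h\<rfloor>) / 2 ^ Suc h"
      by (simp add: diff_divide_distrib)
    moreover have "\<bar>t * 2 ^ Suc h - \<lfloor>t * 2 ^ Suc h\<rfloor>\<bar> \<le> 1" by linarith
    ultimately show ?thesis by (simp only: abs_divide power_divide power_one) (simp add: divide_right_mono)
  qed
  ultimately show "\<bar>t - (real (nat z) - real (grid_offset r h)) / 2 ^ Suc h\<bar> \<le> (1 / 2) ^ Suc h"
    by (simp only: M_def)
qed

lemma grid_covers: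
  assumes "cmod z < 2 ^ r"
  obtains x where "x < grid_size r h" "cmod (z - decode_gauss_rat (grid_code r h x)) \<le> (1 / 2) ^ h"
proof -
  have "\<bar>Re z\<bar> < 2 ^ r" "\<bar>Im z\<bar> < 2 ^ r"
    using assms abs_Re_le_cmod[of z] abs_Im_le_cmod[of z] by linarith+
  then obtain x y where x: "x \<le> 2 * grid_offset r h"
      "\<bar>Re z - (real x - real (grid_offset r h)) / 2 ^ Suc h\<bar> \<le> (1 / 2) ^ Suc h"
    and y: "y \<le> 2 * grid_offset r h"
      "\<bar>Im z - (real y - real (grid_offset r h)) / 2 ^ Suc h\<bar> \<le> (1 / 2) ^ Suc h"
    using dyadic_approx by metis
  have mono: "triangle i \<le> triangle j" if "i \<le> j" for i j
    using that by (induction rule: dec_induct) auto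
  have "ppair x y \<le> ppair (2 * grid_offset r h) (2 * grid_offset r h)"
    using x(1) y(1) unfolding ppair_def prod_encode_def by (simp add: add_mono mono)
  moreover have "cmod (z - decode_gauss_rat (grid_code r h (ppair x y))) \<le> (1 / 2) ^ h"
  proof -
    have "cmod (z - decode_gauss_rat (grid_code r h (ppair x y)))
        \<le> \<bar>Re (z - decode_gauss_rat (grid_code r h (ppair x y)))\<bar>
          + \<bar>Im (z - decode_gauss_rat (grid_code r h (ppair x y)))\<bar>"
      by (rule cmod_le)
    also have "\<dots> \<le> (1 / 2) ^ Suc h + (1 / 2) ^ Suc h"
      using x(2) y(2) by (intro add_mono) (simp_all add: grid_code_def decode_gauss_rat_eq del: power_Suc)
    finally show ?thesis by simp
  qed
  ultimately show ?thesis by (intro that[of "ppair x y"]) (simp_all add: grid_size_def)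
qed

lemma computable_fun_grid_code [computable_intros]:
  "computable_fun R \<Longrightarrow> computable_fun H \<Longrightarrow> computable_fun X \<Longrightarrow>
    computable_fun (\<lambda>e. grid_code (R e) (H e) (X e))"
  unfolding grid_code_def grid_offset_def by (intro computable_intros)

lemma computable_fun_grid_size [computable_intros]:
  "computable_fun R \<Longrightarrow> computable_fun H \<Longrightarrow> computable_fun (\<lambda>e. grid_size (R e) (H e))"
  unfolding grid_size_def grid_offset_def by (intro computable_intros)

section \<open>Computable compactness of the spectrum\<close>

text \<open>
  A certificate of avoidance does not exclude points of small modulus. The spectrum either contains
  \<open>0\<close>, and then the list \<open>l\<close> coding just that point covers those of modulus less than \<open>2\<^sup>-\<^sup>k\<close>, or it
  has a positive distance from \<open>0\<close>, and \<open>l\<close> is empty.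
\<close>

lemma spectrum_near_zero:
  assumes "normal_elem a"
  obtains l j where "\<And>c. c \<in> set (list_decode l) \<Longrightarrow> decode_gauss_rat c \<in> cstar_spectrum a"
    "\<And>k m. m \<in> cstar_spectrum a \<Longrightarrow> (1 / 2) ^ (k + j) \<le> cmod m
      \<or> (\<exists>c\<in>set (list_decode l). cmod (m - decode_gauss_rat c) < (1 / 2) ^ k)"
proof (cases "0 \<in> cstar_spectrum a")
  case True
  define z where "z = ppair (rat_code_dyadic 0 0 0) (rat_code_dyadic 0 0 0)"
  have z: "decode_gauss_rat z = 0" by (simp add: z_def decode_gauss_rat_eq complex_eq_iff)
  show ?thesis
    by (rule that[of "Suc (ppair z 0)" 0]) (auto simp: z True not_less)
next
  case False
  then obtain c where c: "0 < c" "\<And>x. c * norm x \<le> norm (shifted_mult a 0 x)"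
    using not_in_spectrum_imp_bounded_below[OF False] by blast
  obtain j where j: "(1 / 2) ^ j < c" using real_arch_pow_inv[of c "1 / 2"] c(1) by auto
  have "(1 / 2) ^ (k + j) \<le> cmod m" if "m \<in> cstar_spectrum a" for k m
  proof -
    have "c \<le> cmod m"
      using not_in_spectrum_nearby[OF assms c, of m] that by (force simp: not_less)
    moreover have "(1 / 2) ^ (k + j) \<le> (1 / 2 :: real) ^ j" by (intro power_decreasing) auto
    ultimately show ?thesis using j by linarith
  qed
  then show ?thesis by (intro that[of 0 j]) auto
qed

theorem theorem3p6:
  fixes N :: enat and s :: "nat \<Rightarrow> 'a::cstar_algebra" and a :: 'a
  assumes "computable_presentation N s"
    and "normal_elem a"
    and "computable_point N s a"
  shows "computably_compact (cstar_spectrum a)"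
proof -
  let ?K = "cstar_spectrum a"
  have pres: "presentation N s" using assms(1) by (simp add: computable_presentation_def)
  obtain fa where fa: "recursive 1 fa" "\<And>k. is_code N (fa [k])"
    "\<And>k. norm (a - generated_point s (fa [k])) < (1 / 2) ^ k"
    using assms(3) by (auto simp: computable_point_def)
  define p where "p j = fa [j]" for j
  have p_comp: "computable_fun p"
    using recursive_imp_computable_fun[OF fa(1)] by (simp add: p_def[abs_def])
  have p_code: "is_code N (p j)" and p: "norm (a - generated_point s (p j)) \<le> (1 / 2) ^ j" for j
    using fa(2,3)[of j] by (simp_all add: p_def less_imp_le)
  obtain r0 :: nat where "norm a < 2 ^ r0" using real_arch_pow[of 2 "norm a"] by auto
  \<comment> \<open>A positive \<open>r\<close> makes \<open>2\<^sup>-\<^sup>h\<^sup>(\<^sup>k\<^sup>)\<close> less than \<open>2\<^sup>-\<^sup>k\<close>: the balls of the cover are open.\<close>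
  define r where "r = Suc r0"
  have r: "norm a < 2 ^ r"
    using \<open>norm a < 2 ^ r0\<close> norm_ge_zero[of a] unfolding r_def power_Suc by linarith
  obtain l j0 where l: "\<And>c. c \<in> set (list_decode l) \<Longrightarrow> decode_gauss_rat c \<in> ?K"
    and j0: "\<And>k m. m \<in> ?K \<Longrightarrow> (1 / 2) ^ (k + j0) \<le> cmod m
      \<or> (\<exists>c\<in>set (list_decode l). cmod (m - decode_gauss_rat c) < (1 / 2) ^ k)"
    using spectrum_near_zero[OF assms(2)] by blast
  \<comment> \<open>Points of modulus at least \<open>2\<^sup>-\<^sup>(\<^sup>k\<^sup>+\<^sup>j\<^sup>0\<^sup>)\<close> are to be excluded; this is the matching mesh.\<close>
  define h where "h k = k + j0 + k + r" for k
  \<comment> \<open>The environment \<open>e\<close> codes the accuracy \<open>k\<close> and a grid index, the candidate \<open>t\<close> a tag, a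
      polynomial and an accuracy for \<open>a\<close>.\<close>
  define g where "g e = grid_code r (h (pfst e)) (psnd e)" for e
  define b where "b t = code_or_zero N (pfst (psnd t))" for t
  define J where "J t = psnd (psnd t)" for t :: nat
  define X where "X e t = (if pfst t = 0
    then meeting_excess (pfst e) (generated_point s (p (J t))) (decode_gauss_rat (g e)) (J t)
      (generated_point s (b t))
    else avoiding_excess (pfst e + j0) (h (pfst e)) (generated_point s (p (J t)))
      (decode_gauss_rat (g e)) (J t) (generated_point s (b t)))" for e t
  have X_comp: "computable_real (\<lambda>t. X (pfst t) (psnd t))"
    unfolding X_def
    by (intro computable_real_If computable_real_meeting_excess[OF assms(1)]
        computable_real_avoiding_excess[OF assms(1)])
      (unfold b_def J_def g_def h_def,
       (intro computable_intros computable_fun_comp[OF p_comp] p_code is_code_code_or_zero)+)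
  have "\<exists>t. 0 < X e t" for e
  proof -
    obtain c j where "is_code N c"
      "0 < meeting_excess (pfst e) (generated_point s (p j)) (decode_gauss_rat (g e)) j (generated_point s c)
      \<or> 0 < avoiding_excess (pfst e + j0) (h (pfst e)) (generated_point s (p j)) (decode_gauss_rat (g e)) j
          (generated_point s c)"
      using search_succeeds[OF pres assms(2) r, of "\<lambda>j. generated_point s (p j)" "pfst e"
          "decode_gauss_rat (g e)" "pfst e + j0"] p unfolding h_def by blast
    then have "0 < X e (ppair 0 (ppair c j)) \<or> 0 < X e (ppair 1 (ppair c j))"
      by (auto simp: X_def b_def J_def)
    then show ?thesis by blast
  qed
  then obtain sel where sel: "computable_fun sel" "\<And>e. 0 < X e (sel e)"
    using computable_selection[OF X_comp] by metis
  define F where "F k = rec_nat l (\<lambda>x acc. if pfst (sel (ppair k x)) = 0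
    then Suc (ppair (g (ppair k x)) acc) else acc) (grid_size r (h k))" for k
  have "computable_fun F"
    unfolding F_def g_def h_def
    by (intro computable_intros computable_fun_comp[OF sel(1)] decidable_eq_0)
  then obtain f where f: "recursive 1 f" "\<And>k. f [k] = F k"
    using computable_fun_imp_recursive by blast
  have set_F: "set (list_decode (F k)) = set (list_decode l)
      \<union> {g (ppair k x) | x. x < grid_size r (h k) \<and> pfst (sel (ppair k x)) = 0}" for k
  proof -
    have "set (list_decode (rec_nat l (\<lambda>x acc. if pfst (sel (ppair k x)) = 0
        then Suc (ppair (g (ppair k x)) acc) else acc) n)) = set (list_decode l)
        \<union> {g (ppair k x) | x. x < n \<and> pfst (sel (ppair k x)) = 0}" for n
      by (induction n) (auto simp: less_Suc_eq)
    then show ?thesis by (simp add: F_def)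
  qed
  have meets: "\<exists>m\<in>?K. cmod (m - decode_gauss_rat c) < (1 / 2) ^ k"
    if c: "c \<in> set (list_decode (F k))" for c k
  proof (cases "c \<in> set (list_decode l)")
    case True
    then show ?thesis using l by (intro bexI[of _ "decode_gauss_rat c"]) auto
  next
    case False
    then obtain x where x: "c = g (ppair k x)" "pfst (sel (ppair k x)) = 0"
      using c by (auto simp: set_F)
    then show ?thesis
      using sel(2)[of "ppair k x"] meeting_excess_sound[OF assms(2) p] by (simp add: X_def)
  qed
  have covers: "\<exists>c\<in>set (list_decode (F k)). cmod (m - decode_gauss_rat c) < (1 / 2) ^ k"
    if m: "m \<in> ?K" for m k
    using j0[OF m, of k]
  proof
    assume large: "(1 / 2) ^ (k + j0) \<le> cmod m"
    have "cmod m < 2 ^ r" using spectrum_norm_le[OF assms(2) m] r by linarith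
    then obtain x where x: "x < grid_size r (h k)"
      "cmod (m - decode_gauss_rat (g (ppair k x))) \<le> (1 / 2) ^ h k"
      using grid_covers[of m r "h k"] by (auto simp: g_def)
    have "pfst (sel (ppair k x)) = 0"
    proof (rule ccontr)
      assume "pfst (sel (ppair k x)) \<noteq> 0"
      then have "cmod m < (1 / 2) ^ (k + j0)"
        using sel(2)[of "ppair k x"] avoiding_excess_sound[OF assms(2) p _ m] x(2)
        by (simp add: X_def)
      then show False using large by simp
    qed
    moreover have "(1 / 2) ^ h k < (1 / 2 :: real) ^ k"
      by (rule power_strict_decreasing) (simp_all add: h_def r_def)
    ultimately show ?thesis
      using x by (intro bexI[of _ "g (ppair k x)"] le_less_trans[OF x(2)]) (auto simp: set_F)
  next
    assume "\<exists>c\<in>set (list_decode l). cmod (m - decode_gauss_rat c) < (1 / 2) ^ k"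
    then show ?thesis by (auto simp: set_F)
  qed
  have "\<forall>k. let B = set (list_decode (f [k])) in
      ?K \<subseteq> (\<Union>c\<in>B. ball (decode_gauss_rat c) ((1 / 2) ^ k)) \<and>
      (\<forall>c\<in>B. ball (decode_gauss_rat c) ((1 / 2) ^ k) \<inter> ?K \<noteq> {})"
    unfolding Let_def
  proof (intro allI conjI subsetI ballI)
    fix k m assume "m \<in> ?K"
    then show "m \<in> (\<Union>c\<in>set (list_decode (f [k])). ball (decode_gauss_rat c) ((1 / 2) ^ k))"
      using covers[of m k] by (auto simp: f(2) dist_norm norm_minus_commute)
  next
    fix k c assume "c \<in> set (list_decode (f [k]))"
    then obtain m where "m \<in> ?K" "cmod (m - decode_gauss_rat c) < (1 / 2) ^ k"
      using meets[of c k] by (auto simp: f(2))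
    then show "ball (decode_gauss_rat c) ((1 / 2) ^ k) \<inter> ?K \<noteq> {}"
      by (auto simp: dist_norm norm_minus_commute)
  qed
  then show ?thesis
    unfolding computably_compact_def using compact_spectrum[OF assms(2)] f(1) by blast
qed

end
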